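(* Let $T$ be a locally finite tree with a fixed root at infinity $\omega\in\partial T$ and reference vertex $o$, in which every vertex has at least one successor. Let $m$ be a flow measure on $T$ and let $\sigma:\mathbb Z\to(0,\infty)$ satisfy $\sum_{n\le k}\sigma(n)<\infty$ for every $k\in\mathbb Z$ and $\sum_{n=0}^\infty \frac{1}{\sigma(n)\,m(p^n(o))}<\infty$. Then the Bergman projection $\mathcal P$ is bounded on $L^p(m\cdot\sigma)$ for every $p\in(1,\infty)$, and it is bounded from $L^1(m\cdot\sigma)$ to $L^{1,\infty}(m\cdot\sigma)$.
   Context: Tree notation. $T$ is an infinite locally finite tree with graph distance $d$ and a fixed reference vertex $o$. The boundary $\partial T$ is the set of equivalence classes of infinite geodesics starting at $o$ (two being equivalent if they eventually coincide). Fix $\omega\in\partial T$; let $[o,\omega)=\{x_n\}_{n\ge0}$ be the geodesic ray from $o$ (with $x_0=o$) representing $\omega$. The level is $\ell(x)=\lim_{n\to\infty}(n-d(x,x_n))$. For each vertex $x$, $p(x)$ is the unique neighbour with $\ell(p(x))=\ell(x)+1$, and $s(x)$ is the set of the other neighbours (successors). $p^0(x)=x$, $p^n(x)=p(p^{n-1}(x))$; $s_0(x)=\{x\}$, $s_n(x)=\bigcup_{y\in s_{n-1}(x)}s(y)$. It is assumed that $s(x)\neq\emptyset$ for all $x$. $T_x=\bigcup_{n\ge0}s_n(x)$ and $\dot T_x=T_x\setminus\{x\}$. A flow measure is a function $m:T\to(0,\infty)$ with $m(x)=\sum_{y\in s(x)}m(y)$ for all $x$. The function $\sigma$ on $\mathbb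 Z$ is also viewed as a function on $T$ via $\sigma(x)=\sigma(\ell(x))$, and $m\cdot\sigma$ is the measure on $T$ giving mass $m(x)\sigma(x)$ to the vertex $x$. For $n\in\mathbb Z$, $x\in T$, set $S_{n,x}(\sigma)=\sum_{k=0}^\infty\sigma(\ell(x)+n-k)$. For $v,z,x\in T$ set $\Psi(v,z,x)=0$ if $\{x,z\}\not\subset\dot T_v$; $\Psi(v,z,x)=\frac1{m(y)}-\frac1{m(v)}$ if $\{x,z\}\subset T_y$ for some $y\in s(v)$; and $\Psi(v,z,x)=-\frac1{m(v)}$ otherwise. Set $$K(x,y)=\sum_{n=0}^\infty\frac{\Psi(p^{n+1}(x),p^n(x),y)}{S_{n,x}(\sigma)},\qquad x,y\in T.$$ The Bergman projection is the operator defined on $f\in L^2(m\cdot\sigma)$ by $\mathcal Pf(x)=\sum_{y\in T}K(x,y)f(y)m(y)\sigma(y)$, $x\in T$. "$\mathcal P$ is bounded on $L^p(m\cdot\sigma)$" means that there is $C$ with $\|\mathcal Pf\|_{L^p(m\cdot\sigma)}\le C\|f\|_{L^p(m\cdot\sigma)}$ for all $f\in L^2(m\cdot\sigma)\cap L^p(m\cdot\sigma)$ (so that $\mathcal P$ extends boundedly to $L^p$). "Bounded from $L^1$ to $L^{1,\infty}$" means that there is $C$ with $(m\cdot\sigma)(\{x:|\mathcal Pf(x)|>\lambda\})\le C\|f\|_{L^1(m\cdot\sigma)}/\lambda$ for all $\lambda>0$ and all $f\in L^1(m\cdot\sigma)\cap L^2(m\cdot\sigma)$. *)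

theory Defs
  imports "HOL-Analysis.Analysis"
begin

text \<open>
  A graph is given by its adjacency relation \<open>E\<close>; the vertex set is the whole type \<open>'a\<close>.
\<close>

definition graph_cycle :: "'a rel \<Rightarrow> 'a list \<Rightarrow> bool" where
  "graph_cycle E vs \<longleftrightarrow>
     length vs \<ge> 3 \<and> distinct vs \<and> successively (\<lambda>x y. (x, y) \<in> E) vs \<and> (last vs, hd vs) \<in> E"

definition graph_tree :: "'a rel \<Rightarrow> bool" where
  "graph_tree E \<longleftrightarrow>
     sym E \<and> irrefl E \<and> (\<forall>x y. (x, y) \<in> E\<^sup>*) \<and> (\<nexists>vs. graph_cycle E vs)"

definition locally_finite_graph :: "'a rel \<Rightarrow> bool" where
  "locally_finite_graph E \<longleftrightarrow> (\<forall>x. finite {y. (x, y) \<in> E})"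

definition graph_dist :: "'a rel \<Rightarrow> 'a \<Rightarrow> 'a \<Rightarrow> nat" where
  "graph_dist E x y = (LEAST n. (x, y) \<in> E ^^ n)"

text \<open>The reference vertex is called \<open>r\<close>, since \<open>o\<close> is reserved for function composition.\<close>

definition geodesic_rays :: "'a rel \<Rightarrow> 'a \<Rightarrow> (nat \<Rightarrow> 'a) set" where
  "geodesic_rays E r =
     {x. x 0 = r \<and> (\<forall>i j. int (graph_dist E (x i) (x j)) = \<bar>int i - int j\<bar>)}"

definition eventually_coincide :: "'a rel \<Rightarrow> 'a \<Rightarrow> (nat \<Rightarrow> 'a) rel" where
  "eventually_coincide E r =
     {(x, y). x \<in> geodesic_rays E r \<and> y \<in> geodesic_rays E r \<and> (\<forall>\<^sub>F n in sequentially. x n = y n)}"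

definition tree_boundary :: "'a rel \<Rightarrow> 'a \<Rightarrow> (nat \<Rightarrow> 'a) set set" where
  "tree_boundary E r = geodesic_rays E r // eventually_coincide E r"

text \<open>
  The ray \<open>[r, \<omega>)\<close>. In a tree two geodesic rays with the same origin that eventually coincide
  are equal, so every boundary point has exactly one representative.
\<close>

definition boundary_ray :: "(nat \<Rightarrow> 'a) set \<Rightarrow> nat \<Rightarrow> 'a" where
  "boundary_ray \<omega> = (THE x. x \<in> \<omega>)"

text \<open>The limit is taken in the discrete space \<open>int\<close>; the sequence is eventually constant.\<close>

definition level :: "'a rel \<Rightarrow> (nat \<Rightarrow> 'a) set \<Rightarrow> 'a \<Rightarrow> int" where
  "level E \<omega> x = lim (\<lambda>n. int n - int (graph_dist E x (boundary_ray \<omega> n)))"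

definition predecessor :: "'a rel \<Rightarrow> (nat \<Rightarrow> 'a) set \<Rightarrow> 'a \<Rightarrow> 'a" where
  "predecessor E \<omega> x = (THE y. (x, y) \<in> E \<and> level E \<omega> y = level E \<omega> x + 1)"

definition successors :: "'a rel \<Rightarrow> (nat \<Rightarrow> 'a) set \<Rightarrow> 'a \<Rightarrow> 'a set" where
  "successors E \<omega> x = {y. (x, y) \<in> E} - {predecessor E \<omega> x}"

primrec nth_successors :: "'a rel \<Rightarrow> (nat \<Rightarrow> 'a) set \<Rightarrow> nat \<Rightarrow> 'a \<Rightarrow> 'a set" where
  "nth_successors E \<omega> 0 x = {x}"
| "nth_successors E \<omega> (Suc n) x = (\<Union>y\<in>nth_successors E \<omega> n x. successors E \<omega> y)"

definition sector :: "'a rel \<Rightarrow> (nat \<Rightarrow> 'a) set \<Rightarrow> 'a \<Rightarrow> 'a set" where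
  "sector E \<omega> x = (\<Union>n. nth_successors E \<omega> n x)"

definition punctured_sector :: "'a rel \<Rightarrow> (nat \<Rightarrow> 'a) set \<Rightarrow> 'a \<Rightarrow> 'a set" where
  "punctured_sector E \<omega> x = sector E \<omega> x - {x}"

definition flow_measure :: "'a rel \<Rightarrow> (nat \<Rightarrow> 'a) set \<Rightarrow> ('a \<Rightarrow> real) \<Rightarrow> bool" where
  "flow_measure E \<omega> m \<longleftrightarrow> (\<forall>x. m x > 0) \<and> (\<forall>x. m x = (\<Sum>y\<in>successors E \<omega> x. m y))"

definition weighted_measure ::
    "'a rel \<Rightarrow> (nat \<Rightarrow> 'a) set \<Rightarrow> ('a \<Rightarrow> real) \<Rightarrow> (int \<Rightarrow> real) \<Rightarrow> 'a measure" where
  "weighted_measure E \<omega> m \<sigma> = point_measure UNIV (\<lambda>x. ennreal (m x * \<sigma> (level E \<omega> x)))"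

definition S_sum :: "'a rel \<Rightarrow> (nat \<Rightarrow> 'a) set \<Rightarrow> (int \<Rightarrow> real) \<Rightarrow> int \<Rightarrow> 'a \<Rightarrow> real" where
  "S_sum E \<omega> \<sigma> n x = (\<Sum>k. \<sigma> (level E \<omega> x + n - int k))"

definition Psi :: "'a rel \<Rightarrow> (nat \<Rightarrow> 'a) set \<Rightarrow> ('a \<Rightarrow> real) \<Rightarrow> 'a \<Rightarrow> 'a \<Rightarrow> 'a \<Rightarrow> real" where
  "Psi E \<omega> m v z x =
     (if \<not> {x, z} \<subseteq> punctured_sector E \<omega> v then 0
      else if \<exists>y\<in>successors E \<omega> v. {x, z} \<subseteq> sector E \<omega> y
        then 1 / m (THE y. y \<in> successors E \<omega> v \<and> {x, z} \<subseteq> sector E \<omega> y) - 1 / m v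
      else - (1 / m v))"

definition Bergman_kernel ::
    "'a rel \<Rightarrow> (nat \<Rightarrow> 'a) set \<Rightarrow> ('a \<Rightarrow> real) \<Rightarrow> (int \<Rightarrow> real) \<Rightarrow> 'a \<Rightarrow> 'a \<Rightarrow> real" where
  "Bergman_kernel E \<omega> m \<sigma> x y =
     (\<Sum>n. Psi E \<omega> m ((predecessor E \<omega> ^^ (n + 1)) x) ((predecessor E \<omega> ^^ n) x) y
           / S_sum E \<omega> \<sigma> (int n) x)"

definition Bergman_projection ::
    "'a rel \<Rightarrow> (nat \<Rightarrow> 'a) set \<Rightarrow> ('a \<Rightarrow> real) \<Rightarrow> (int \<Rightarrow> real) \<Rightarrow> ('a \<Rightarrow> complex) \<Rightarrow> 'a \<Rightarrow> complex"
  where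
  "Bergman_projection E \<omega> m \<sigma> f x =
     (\<Sum>\<^sub>\<infinity>y\<in>UNIV. complex_of_real (Bergman_kernel E \<omega> m \<sigma> x y) * f y
        * complex_of_real (m y * \<sigma> (level E \<omega> y)))"

definition Lp_space :: "'a measure \<Rightarrow> real \<Rightarrow> ('a \<Rightarrow> complex) set" where
  "Lp_space M p = {f \<in> borel_measurable M. integrable M (\<lambda>x. norm (f x) powr p)}"

definition Lp_norm :: "'a measure \<Rightarrow> real \<Rightarrow> ('a \<Rightarrow> complex) \<Rightarrow> real" where
  "Lp_norm M p f = (\<integral>x. norm (f x) powr p \<partial>M) powr (1 / p)"

text \<open>
  The condition \<open>P f \<in> Lp_space M p\<close> expresses that the \<open>L\<^sup>p\<close> norm of \<open>P f\<close> is finite: the Bochner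
  integral in \<open>Lp_norm\<close> is \<open>0\<close> for a non-integrable function.
\<close>

definition bounded_on_Lp :: "'a measure \<Rightarrow> (('a \<Rightarrow> complex) \<Rightarrow> 'a \<Rightarrow> complex) \<Rightarrow> real \<Rightarrow> bool" where
  "bounded_on_Lp M P p \<longleftrightarrow>
     (\<exists>C::real. \<forall>f \<in> Lp_space M 2 \<inter> Lp_space M p.
        P f \<in> Lp_space M p \<and> Lp_norm M p (P f) \<le> C * Lp_norm M p f)"

definition weak_type_1_1 :: "'a measure \<Rightarrow> (('a \<Rightarrow> complex) \<Rightarrow> 'a \<Rightarrow> complex) \<Rightarrow> bool" where
  "weak_type_1_1 M P \<longleftrightarrow>
     (\<exists>C\<ge>0. \<forall>t>0. \<forall>f \<in> Lp_space M 1 \<inter> Lp_space M 2.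
        emeasure M {x \<in> space M. norm (P f x) > t} \<le> ennreal (C * Lp_norm M 1 f / t))"

end

theory Submission
  imports Defs
begin

text \<open>
Let \<open>E_j\<close> denote averaging, with respect to the flow measure, over the vertices of a fixed level below a
vertex of level \<open>j\<close>. At a vertex of level \<open>k\<close>, the projection sums over all \<open>j \<ge> k\<close> the differences
\<open>E_j - E_(j+1)\<close> of the function obtained from \<open>f\<close> by averaging the levels \<open>\<le> j\<close> with the weights \<open>\<sigma>\<close>. This makes it a
martingale transform. The chain of sets around a vertex \<open>x\<close>,
\<open>{x} \<subset> T_x \<subset> T_v - {v} \<subset> T_v \<subset> \<dots>\<close> with \<open>v = p(x)\<close>, comes from a filtration:
\<open>T_x\<close> splits into \<open>{x}\<close> and \<open>T_x - {x}\<close>, and \<open>T_v - {v}\<close> splits into the sectors of the successors of \<open>v\<close>.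
The projection \<open>\<P> f\<close> keeps exactly the martingale differences of \<open>f\<close> of the second kind. Burkholder's
theory of martingale transforms then gives the \<open>L\<^sup>p\<close> and weak \<open>L\<^sup>1\<close> bounds.

Burkholder's argument can be carried out with finite sums only. Let \<open>u\<close> and \<open>v\<close> be
the sums of the differences that are kept and dropped, so that \<open>u + v\<close> is the running average of \<open>f\<close>. Each
splitting changes only one of them, hence a function \<open>W(u, v)\<close> that is concave in each variable separately
has a decreasing total along the filtration (\<open>zigzag_step\<close>). If moreover
\<open>0 \<le> H(u) \<le> W(u, v) + G(u + v)\<close> with \<open>G(0) = 0\<close>, and \<open>W(u, v)\<close> is at most of order \<open>max \<bar>u\<bar> \<bar>v\<bar> powr q\<close> at the
origin for some \<open>q > 1\<close>, then \<open>\<Sum> \<mu> H(\<P> f) \<le> \<Sum> \<mu> G(f)\<close> for every finitely supported real \<open>f\<close>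
(\<open>burkholder_bound\<close>): below the support of
\<open>f\<close> the running average is zero and \<open>W \<ge> H \<ge> 0\<close>, while at high ancestors \<open>x\<close> of the reference vertex \<open>u\<close> and \<open>v\<close>
are of order \<open>1 / \<mu>(T_x)\<close> and \<open>\<mu>(T_x)\<close> tends to infinity. Two choices of \<open>W\<close> yield the strong and the weak
bound.

For general \<open>f\<close> the series defining \<open>\<P> f(x)\<close> converges absolutely because \<open>K(x, \<cdot>)\<close> is square summable.
This follows from the finite bound for \<open>p = 2\<close> applied to a point mass, as the kernel is symmetric.
The bounds then pass to the limit one finite set of vertices at a time, by Fatou's argument.
\<close>

section \<open>Trees seen from a boundary point\<close>

text \<open>
Erasing loops turns any walk into a path. The condition on the vertices of the path makes it inherit from
the relation that it avoids a given vertex.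
\<close>

lemma rtrancl_distinct_path:
  assumes "(a, b) \<in> R\<^sup>*"
  shows "\<exists>vs. vs \<noteq> [] \<and> hd vs = a \<and> last vs = b \<and> distinct vs
    \<and> successively (\<lambda>x y. (x, y) \<in> R) vs \<and> set vs \<subseteq> insert b (Domain R)"
  using assms
proof (induction rule: converse_rtrancl_induct)
  case base
  show ?case by (intro exI[of _ "[b]"]) auto
next
  case (step a a')
  then obtain vs where vs: "vs \<noteq> []" "hd vs = a'" "last vs = b" "distinct vs"
    "successively (\<lambda>x y. (x, y) \<in> R) vs" "set vs \<subseteq> insert b (Domain R)" by blast
  show ?case
  proof (cases "a \<in> set vs")
    case True
    then obtain us ws where "vs = us @ a # ws" by (meson split_list)
    with vs show ?thesis by (intro exI[of _ "a # ws"]) (auto simp: successively_append_iff)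
  next
    case False
    with vs step.hyps show ?thesis
      by (intro exI[of _ "a # vs"]) (auto simp: successively_Cons)
  qed
qed

locale tree_graph =
  fixes E :: "'a rel"
  assumes tree: "graph_tree E"
begin

lemma edge_sym: "(x, y) \<in> E \<Longrightarrow> (y, x) \<in> E"
  using tree by (auto simp: graph_tree_def sym_def)

lemma edge_irrefl: "(x, x) \<notin> E"
  using tree by (auto simp: graph_tree_def irrefl_def)

lemma connected: "(x, y) \<in> E\<^sup>*"
  using tree by (auto simp: graph_tree_def)

lemma relpow_graph_dist: "(x, y) \<in> E ^^ graph_dist E x y"
proof -
  obtain n where "(x, y) \<in> E ^^ n" using connected[of x y] by (auto simp: rtrancl_power)
  then show ?thesis unfolding graph_dist_def by (rule LeastI)
qed

lemma graph_dist_le: "(x, y) \<in> E ^^ n \<Longrightarrow> graph_dist E x y \<le> n"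
  unfolding graph_dist_def by (rule Least_le)

lemma graph_dist_triangle: "graph_dist E x z \<le> graph_dist E x y + graph_dist E y z"
proof (rule graph_dist_le)
  show "(x, z) \<in> E ^^ (graph_dist E x y + graph_dist E y z)"
    unfolding relpow_add by (rule relcompI) (rule relpow_graph_dist)+
qed

lemma graph_dist_eq_0: "graph_dist E x y = 0 \<longleftrightarrow> x = y"
  using relpow_graph_dist[of x y] graph_dist_le[of x y 0] by auto

lemma graph_dist_edge: "(x, y) \<in> E \<Longrightarrow> graph_dist E x y \<le> 1"
  by (rule graph_dist_le) simp

lemma edge_of_graph_dist: "graph_dist E x y = 1 \<Longrightarrow> (x, y) \<in> E"
  using relpow_graph_dist[of x y] by simp

lemma closer_neighbour:
  assumes "graph_dist E x z = Suc k"
  shows "\<exists>c. (x, c) \<in> E \<and> graph_dist E c z = k"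
proof -
  obtain c where c: "(x, c) \<in> E" "(c, z) \<in> E ^^ k"
    using relpow_graph_dist[of x z] assms by (metis relpow_Suc_D2)
  have "Suc k \<le> 1 + graph_dist E c z"
    using graph_dist_triangle[of x z c] graph_dist_edge[OF c(1)] assms by linarith
  with c graph_dist_le[OF c(2)] show ?thesis by (intro exI[of _ c]) auto
qed

text \<open>
A geodesic from \<open>c\<close> to \<open>z\<close> gets closer to \<open>z\<close> at each step, so it cannot pass through \<open>x\<close> when \<open>x\<close> is at
least as far from \<open>z\<close> as \<open>c\<close> is.
\<close>

lemma connected_avoiding:
  assumes "c \<noteq> x" "graph_dist E c z \<le> graph_dist E x z"
  shows "(c, z) \<in> {(a, b) \<in> E. a \<noteq> x \<and> b \<noteq> x}\<^sup>*"
  using assms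
proof (induction "graph_dist E c z" arbitrary: c)
  case 0
  then have "c = z" by (simp add: graph_dist_eq_0[symmetric])
  then show ?case by simp
next
  case (Suc k)
  then obtain c' where c': "(c, c') \<in> E" "graph_dist E c' z = k"
    using closer_neighbour[of c z k] by auto
  with Suc have "c' \<noteq> x" by auto
  with c' Suc have "(c', z) \<in> {(a, b) \<in> E. a \<noteq> x \<and> b \<noteq> x}\<^sup>*" by simp
  moreover have "(c, c') \<in> {(a, b) \<in> E. a \<noteq> x \<and> b \<noteq> x}"
    using c' Suc.prems \<open>c' \<noteq> x\<close> by simp
  ultimately show ?case by (rule converse_rtrancl_into_rtrancl[rotated])
qed

text \<open>
This is the only place where the absence of cycles enters. Two such neighbours could be joined without using \<open>x\<close>,
by going from each of them to \<open>z\<close>, and adding \<open>x\<close> would close a cycle. The weak inequality in the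
hypothesis excludes equidistant neighbours as well, so that all other neighbours are strictly farther away.
\<close>

lemma unique_closer_neighbour:
  assumes a: "(x, a) \<in> E" "graph_dist E a z \<le> graph_dist E x z"
    and b: "(x, b) \<in> E" "graph_dist E b z \<le> graph_dist E x z"
  shows "a = b"
proof (rule ccontr)
  assume ab: "a \<noteq> b"
  let ?R = "{(u, v) \<in> E. u \<noteq> x \<and> v \<noteq> x}"
  have ne: "a \<noteq> x" "b \<noteq> x" using a b edge_irrefl by auto
  have "sym ?R" by (auto simp: sym_def edge_sym)
  then have "(a, b) \<in> ?R\<^sup>*"
    using connected_avoiding[OF ne(1) a(2)] connected_avoiding[OF ne(2) b(2)]
    by (meson rtrancl_trans symD sym_rtrancl)
  from rtrancl_distinct_path[OF this] obtain vs where vs: "vs \<noteq> []" "hd vs = a" "last vs = b"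
    "distinct vs" "successively (\<lambda>x y. (x, y) \<in> ?R) vs" "set vs \<subseteq> insert b (Domain ?R)" by blast
  have "x \<notin> set vs" using vs(6) ne by auto
  moreover have "length vs \<ge> 2"
    using vs(1-3) ab by (cases vs; cases "tl vs") auto
  moreover have "successively (\<lambda>x y. (x, y) \<in> E) vs"
    using vs(5) by (rule successively_mono) auto
  ultimately have "graph_cycle E (x # vs)"
    using vs(1-4) a(1) b(1) edge_sym by (auto simp: graph_cycle_def successively_Cons)
  then show False using tree by (auto simp: graph_tree_def)
qed

lemma graph_dist_neighbour:
  assumes "(x, y) \<in> E"
  shows "\<bar>int (graph_dist E x z) - int (graph_dist E y z)\<bar> = 1"
proof -
  have eq: "graph_dist E x z \<noteq> graph_dist E y z"
  proof
    assume eq: "graph_dist E x z = graph_dist E y z"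
    show False
    proof (cases "graph_dist E x z")
      case 0
      with eq have "x = z" "y = z" by (simp_all add: graph_dist_eq_0[symmetric])
      with assms edge_irrefl show False by simp
    next
      case (Suc k)
      then obtain c where c: "(x, c) \<in> E" "graph_dist E c z = k" using closer_neighbour by blast
      with unique_closer_neighbour[of x c z y] assms eq Suc show False by auto
    qed
  qed
  have "graph_dist E x z \<le> 1 + graph_dist E y z" "graph_dist E y z \<le> 1 + graph_dist E x z"
    using graph_dist_triangle[of x z y] graph_dist_triangle[of y z x] graph_dist_edge[OF assms]
      graph_dist_edge[OF edge_sym[OF assms]] by linarith+
  with eq show ?thesis by linarith
qed

end

locale tree_with_end = tree_graph +
  fixes r :: 'a and \<omega> :: "(nat \<Rightarrow> 'a) set"
  assumes locally_finite: "locally_finite_graph E"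
    and boundary: "\<omega> \<in> tree_boundary E r"
begin

lemma boundary_ray: "boundary_ray \<omega> \<in> geodesic_rays E r"
proof -
  obtain x where x: "x \<in> geodesic_rays E r" "\<omega> = eventually_coincide E r `` {x}"
    using boundary by (auto simp: tree_boundary_def quotient_def)
  have "y = x" if "y \<in> \<omega>" for y
  proof -
    have y: "y \<in> geodesic_rays E r" and "\<forall>\<^sub>F n in sequentially. x n = y n"
      using that x by (auto simp: eventually_coincide_def)
    then obtain N where N: "\<And>n. n \<ge> N \<Longrightarrow> x n = y n" by (auto simp: eventually_sequentially)
    have d: "graph_dist E (w i) (w j) = nat \<bar>int i - int j\<bar>" "w 0 = r"
      if "w \<in> geodesic_rays E r" for w i j
    proof -
      have "int (graph_dist E (w i) (w j)) = \<bar>int i - int j\<bar>"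
        using that unfolding geodesic_rays_def by blast
      then show "graph_dist E (w i) (w j) = nat \<bar>int i - int j\<bar>" by linarith
      show "w 0 = r" using that unfolding geodesic_rays_def by blast
    qed
    \<comment> \<open>going back along the rays, both continue to the only neighbour closer to the origin\<close>
    have step: "x n = y n" if "x (Suc n) = y (Suc n)" for n
    proof (rule unique_closer_neighbour[of "x (Suc n)" _ r])
      show "(x (Suc n), x n) \<in> E" by (rule edge_of_graph_dist) (simp add: d[OF x(1)])
      show "(x (Suc n), y n) \<in> E" unfolding that by (rule edge_of_graph_dist) (simp add: d[OF y])
      show "graph_dist E (x n) r \<le> graph_dist E (x (Suc n)) r"
        using d(1)[OF x(1), of _ 0] d(2)[OF x(1)] by simp
      show "graph_dist E (y n) r \<le> graph_dist E (x (Suc n)) r"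
        unfolding that using d(1)[OF y, of _ 0] d(2)[OF y] by simp
    qed
    have "x (N - k) = y (N - k)" for k
    proof (induction k)
      case (Suc k)
      show ?case
      proof (cases "k < N")
        case True
        then have "N - k = Suc (N - Suc k)" by simp
        with Suc step show ?thesis by metis
      qed (use Suc in simp)
    qed (simp add: N)
    then have "x n = y n" for n
      using N[of n] by (metis diff_diff_cancel nle_le)
    then show ?thesis by auto
  qed
  moreover have "x \<in> \<omega>" using x by (simp add: eventually_coincide_def)
  ultimately have "\<omega> = {x}" by blast
  with x(1) show ?thesis by (simp add: boundary_ray_def)
qed

abbreviation "ray \<equiv> boundary_ray \<omega>"

lemma dist_ray: "int (graph_dist E (ray i) (ray j)) = \<bar>int i - int j\<bar>"
  and ray_0: "ray 0 = r"
  using boundary_ray unfolding geodesic_rays_def by blast+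

text \<open>
The sequence defining the level increases, by the triangle inequality along the ray, and it is bounded
by the distance to the origin of the ray.
\<close>

lemma level_eventually:
  "\<forall>\<^sub>F n in sequentially. int n - int (graph_dist E x (ray n)) = level E \<omega> x"
proof -
  let ?h = "\<lambda>n. int n - int (graph_dist E x (ray n))"
  have mono: "incseq ?h"
  proof (rule incseq_SucI)
    fix n
    show "?h n \<le> ?h (Suc n)"
      using graph_dist_triangle[of x "ray (Suc n)" "ray n"] dist_ray[of n "Suc n"] by simp
  qed
  have bound: "?h n \<le> int (graph_dist E r x)" for n
    using graph_dist_triangle[of r "ray n" x] dist_ray[of 0 n] by (simp add: ray_0)
  have fin: "finite (range ?h)"
  proof (rule finite_subset)
    show "range ?h \<subseteq> {?h 0..int (graph_dist E r x)}"
      using bound incseqD[OF mono, of 0] by force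
  qed simp
  obtain N where N: "?h N = Max (range ?h)"
    using Max_in[OF fin] by (auto simp del: Max_in)
  have const: "?h n = ?h N" if "n \<ge> N" for n
    using incseqD[OF mono that] Max_ge[OF fin rangeI[of ?h n]] N by linarith
  then have ev: "\<forall>\<^sub>F n in sequentially. ?h n = ?h N"
    by (rule eventually_sequentiallyI[of N])
  then have "?h \<longlonglongrightarrow> ?h N" by (rule tendsto_eventually)
  then have "level E \<omega> x = ?h N" unfolding level_def by (rule limI)
  with ev show ?thesis by simp
qed

lemma level_origin: "level E \<omega> r = 0"
proof -
  have "\<forall>\<^sub>F n in sequentially. (0::int) = level E \<omega> r"
    using level_eventually[of r] dist_ray[of 0]
    by (auto elim!: eventually_mono simp: ray_0)
  then show ?thesis by simp
qed

lemma level_neighbour: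
  assumes "(x, y) \<in> E"
  shows "level E \<omega> y = level E \<omega> x + 1 \<or> level E \<omega> y = level E \<omega> x - 1"
proof -
  have "\<forall>\<^sub>F n in sequentially. \<bar>level E \<omega> y - level E \<omega> x\<bar> = 1"
    using level_eventually[of x] level_eventually[of y]
  proof eventually_elim
    case (elim n)
    then show ?case using graph_dist_neighbour[OF assms, of "ray n"] by linarith
  qed
  then show ?thesis by auto
qed

text \<open>
Since \<open>x\<close> has finitely many neighbours, for large \<open>n\<close> their levels are read off from the distances to one
vertex of the ray, and the predecessor is the neighbour closer to that vertex.
\<close>

lemma unique_predecessor: "\<exists>!y. (x, y) \<in> E \<and> level E \<omega> y = level E \<omega> x + 1"
proof -
  have fin: "finite {y. (x, y) \<in> E}" using locally_finite by (simp add: locally_finite_graph_def)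
  have "\<forall>\<^sub>F n in sequentially. \<forall>y\<in>{y. (x, y) \<in> E}.
      int n - int (graph_dist E y (ray n)) = level E \<omega> y"
    by (rule eventually_ball_finite[OF fin]) (simp add: level_eventually)
  moreover have "\<forall>\<^sub>F n in sequentially. int n > level E \<omega> x"
    by (intro eventually_sequentiallyI[of "nat (level E \<omega> x + 1)"]) linarith
  ultimately have "\<forall>\<^sub>F n in sequentially. \<exists>!y. (x, y) \<in> E \<and> level E \<omega> y = level E \<omega> x + 1"
    using level_eventually[of x]
  proof eventually_elim
    case (elim n)
    have eq: "(x, y) \<in> E \<and> level E \<omega> y = level E \<omega> x + 1 \<longleftrightarrow>
        (x, y) \<in> E \<and> Suc (graph_dist E y (ray n)) = graph_dist E x (ray n)" for y
      using elim by (cases "(x, y) \<in> E") auto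
    obtain k where k: "graph_dist E x (ray n) = Suc k"
      using elim by (cases "graph_dist E x (ray n)") auto
    then obtain c where c: "(x, c) \<in> E" "graph_dist E c (ray n) = k" using closer_neighbour by blast
    show ?case unfolding eq
    proof (rule ex1I[of _ c])
      show "(x, c) \<in> E \<and> Suc (graph_dist E c (ray n)) = graph_dist E x (ray n)"
        using c k by simp
    next
      fix y assume y: "(x, y) \<in> E \<and> Suc (graph_dist E y (ray n)) = graph_dist E x (ray n)"
      show "y = c" by (rule unique_closer_neighbour[of x _ "ray n"]) (use y c k in linarith)+
    qed
  qed
  then show ?thesis by simp
qed

abbreviation "pr \<equiv> predecessor E \<omega>"

lemma predecessor: "(x, pr x) \<in> E" "level E \<omega> (pr x) = level E \<omega> x + 1"
  using theI'[OF unique_predecessor[of x]] unfolding predecessor_def by blast+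

lemma predecessor_eqI: "(x, y) \<in> E \<Longrightarrow> level E \<omega> y = level E \<omega> x + 1 \<Longrightarrow> pr x = y"
  using unique_predecessor predecessor by blast

lemma successors_eq: "successors E \<omega> x = {y. pr y = x}"
proof (intro set_eqI iffI)
  fix y assume "y \<in> successors E \<omega> x"
  then have y: "(x, y) \<in> E" "y \<noteq> pr x" by (auto simp: successors_def)
  then have "level E \<omega> y = level E \<omega> x - 1" using level_neighbour predecessor_eqI by blast
  then show "y \<in> {y. pr y = x}" using y by (auto intro: predecessor_eqI edge_sym)
next
  fix y assume "y \<in> {y. pr y = x}"
  then have "pr y = x" by simp
  then show "y \<in> successors E \<omega> x"
    using predecessor[of y] predecessor[of x] edge_sym by (force simp: successors_def)
qed

lemma nth_successors_eq: "nth_successors E \<omega> n x = {y. (pr ^^ n) y = x}"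
  by (induction n) (auto simp: successors_eq funpow_swap1)

lemma sector_eq: "sector E \<omega> x = {y. \<exists>n. (pr ^^ n) y = x}"
  by (auto simp: sector_def nth_successors_eq)

lemma finite_successors: "finite {y. pr y = x}"
proof (rule finite_subset)
  show "{y. pr y = x} \<subseteq> {y. (x, y) \<in> E}"
    using edge_sym[OF predecessor(1)] by auto
  show "finite {y. (x, y) \<in> E}" using locally_finite by (simp add: locally_finite_graph_def)
qed

text \<open>
Every edge joins a vertex to its predecessor, so along a walk from \<open>x\<close> to \<open>y\<close> a common ancestor with \<open>x\<close> is
never lost.
\<close>

lemma confluent: "\<exists>n k. (pr ^^ n) x = (pr ^^ k) y"
  using connected[of x y]
proof (induction rule: rtrancl_induct)
  case base
  show ?case by (intro exI[of _ 0]) simp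
next
  case (step y z)
  then obtain n k where nk: "(pr ^^ n) x = (pr ^^ k) y" by blast
  consider "z = pr y" | "pr z = y"
    using successors_eq[of y] step(2) by (auto simp: successors_def)
  then show ?case
  proof cases
    case 1
    then have "(pr ^^ Suc n) x = (pr ^^ k) z" using nk by (simp add: funpow_swap1)
    then show ?thesis by blast
  next
    case 2
    then have "(pr ^^ n) x = (pr ^^ Suc k) z" using nk by (simp add: funpow_swap1)
    then show ?thesis by blast
  qed
qed

end

section \<open>Concave functions of one real variable\<close>

lemma concave_on_UNIV_supergradient:
  fixes f g :: "real \<Rightarrow> real"
  assumes "\<And>x y. f y \<le> f x + g x * (y - x)"
  shows "concave_on UNIV f"
  unfolding concave_on_iff
proof (intro conjI ballI allI impI)
  fix x y u v :: real
  assume uv: "0 \<le> u" "0 \<le> v" "u + v = 1"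
  define z where "z = u *\<^sub>R x + v *\<^sub>R y"
  have "u * f x + v * f y \<le> u * (f z + g z * (x - z)) + v * (f z + g z * (y - z))"
    by (intro add_mono mult_left_mono assms uv)
  also have "\<dots> = (u + v) * f z + g z * (z - (u + v) * z)"
    by (simp add: z_def algebra_simps)
  finally show "u * f x + v * f y \<le> f (u *\<^sub>R x + v *\<^sub>R y)"
    using uv(3) by (simp add: z_def)
qed simp

text \<open>
The exceptional set allows functions that are glued from smooth pieces, as the special functions below are.
The fundamental theorem of calculus tolerates finitely many points and shows that a decreasing derivative
is a supergradient.
\<close>

lemma concave_on_UNIV_antimono_derivative:
  fixes f f' :: "real \<Rightarrow> real"
  assumes "finite S" "continuous_on UNIV f"
    and deriv: "\<And>x. x \<notin> S \<Longrightarrow> (f has_real_derivative f' x) (at x)"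
    and anti: "antimono f'"
  shows "concave_on UNIV f"
proof (rule concave_on_UNIV_supergradient[where g = f'])
  fix x y :: real
  have int: "(f' has_integral (f b - f a)) {a..b}" if "a \<le> b" for a b
    by (rule fundamental_theorem_of_calculus_interior_strong[OF assms(1) that])
      (use deriv assms(2) in \<open>auto simp: has_real_derivative_iff_has_vector_derivative
         intro: continuous_on_subset\<close>)
  have const: "((\<lambda>_. c) has_integral c * (b - a)) {a..b}" if "a \<le> b" for a b c :: real
    using has_integral_const_real[of c a b] that by (simp add: mult.commute)
  show "f y \<le> f x + f' x * (y - x)"
  proof (cases "x \<le> y")
    case True
    have "f y - f x \<le> f' x * (y - x)"
      by (rule has_integral_le[OF int[OF True] const[OF True]]) (use anti in \<open>auto dest: antimonoD\<close>)
    then show ?thesis by simp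
  next
    case False
    then have "y \<le> x" by simp
    have "f' x * (x - y) \<le> f x - f y"
      by (rule has_integral_le[OF const[OF \<open>y \<le> x\<close>] int[OF \<open>y \<le> x\<close>]])
        (use anti in \<open>auto dest: antimonoD\<close>)
    then show ?thesis by (simp add: algebra_simps)
  qed
qed

lemma concave_on_UNIV_reflect:
  fixes f :: "real \<Rightarrow> real"
  assumes "concave_on UNIV f"
  shows "concave_on UNIV (\<lambda>x. f (- x))"
  unfolding concave_on_iff
proof (intro conjI ballI allI impI)
  fix x y u v :: real
  assume "0 \<le> u" "0 \<le> v" "u + v = 1"
  then have "u * f (- x) + v * f (- y) \<le> f (u *\<^sub>R (- x) + v *\<^sub>R (- y))"
    using assms unfolding concave_on_iff by blast
  then show "u * f (- x) + v * f (- y) \<le> f (- (u *\<^sub>R x + v *\<^sub>R y))" by simp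
qed simp

lemma concave_on_min:
  fixes f g :: "real \<Rightarrow> real"
  assumes "concave_on S f" "concave_on S g"
  shows "concave_on S (\<lambda>x. min (f x) (g x))"
  unfolding concave_on_iff
proof (intro conjI ballI allI impI)
  show "convex S" using assms(1) by (rule concave_on_imp_convex)
  fix x y u v :: real
  assume *: "x \<in> S" "y \<in> S" "0 \<le> u" "0 \<le> v" "u + v = 1"
  have "u * min (f x) (g x) + v * min (f y) (g y) \<le> u * f x + v * f y"
    "u * min (f x) (g x) + v * min (f y) (g y) \<le> u * g x + v * g y"
    using * by (intro add_mono mult_left_mono; simp)+
  moreover have "u * f x + v * f y \<le> f (u *\<^sub>R x + v *\<^sub>R y)"
    "u * g x + v * g y \<le> g (u *\<^sub>R x + v *\<^sub>R y)"
    using assms * unfolding concave_on_iff by blast+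
  ultimately show "u * min (f x) (g x) + v * min (f y) (g y)
      \<le> min (f (u *\<^sub>R x + v *\<^sub>R y)) (g (u *\<^sub>R x + v *\<^sub>R y))"
    by simp
qed

lemma concave_on_UNIV_affine: "concave_on UNIV (\<lambda>x::real. a + b * x)"
  by (rule concave_on_UNIV_supergradient[where g = "\<lambda>_. b"]) (simp add: algebra_simps)

lemma weighted_Jensen_concave:
  fixes h :: "real \<Rightarrow> real"
  assumes "concave_on UNIV h" "finite I" and nonneg: "\<And>i. i \<in> I \<Longrightarrow> w i \<ge> 0"
    and mean: "(\<Sum>i\<in>I. w i * x i) = (\<Sum>i\<in>I. w i) * z"
  shows "(\<Sum>i\<in>I. w i * h (x i)) \<le> (\<Sum>i\<in>I. w i) * h z"
proof (cases "(\<Sum>i\<in>I. w i) = 0")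
  case True
  with assms have "\<forall>i\<in>I. w i = 0" by (simp add: sum_nonneg_eq_0_iff)
  then show ?thesis by simp
next
  case False
  let ?W = "\<Sum>i\<in>I. w i"
  have W: "?W > 0" using False nonneg by (metis order_le_less sum_nonneg)
  have "(\<Sum>i\<in>I. w i / ?W * h (x i)) \<le> h (\<Sum>i\<in>I. (w i / ?W) *\<^sub>R x i)"
  proof (rule concave_on_sum[OF assms(2) _ assms(1)])
    show "I \<noteq> {}" using False by auto
    show "(\<Sum>i\<in>I. w i / ?W) = 1" using False by (simp flip: sum_divide_distrib)
  qed (use nonneg W in auto)
  also have "(\<Sum>i\<in>I. (w i / ?W) *\<^sub>R x i) = z"
    using mean False by (simp flip: sum_divide_distrib)
  finally have "(\<Sum>i\<in>I. w i * h (x i)) / ?W \<le> h z" by (simp add: sum_divide_distrib)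
  then show ?thesis using W by (simp add: field_simps)
qed

definition separately_concave :: "(real \<Rightarrow> real \<Rightarrow> real) \<Rightarrow> bool" where
  "separately_concave W \<longleftrightarrow>
     (\<forall>v. concave_on UNIV (\<lambda>u. W u v)) \<and> (\<forall>u. concave_on UNIV (\<lambda>v. W u v))"

lemma separately_concave_symmetric:
  assumes "\<And>u v. W u v = W v u" "\<And>v. concave_on UNIV (\<lambda>u. W u v)"
  shows "separately_concave W"
  unfolding separately_concave_def
proof (intro conjI allI)
  fix u
  have "(\<lambda>v. W v u) = (\<lambda>v. W u v)" by (intro ext assms(1))
  with assms(2)[of u] show "concave_on UNIV (\<lambda>v. W u v)" by (rule back_subst)
qed (rule assms(2))

section \<open>The special functions of the zigzag estimates\<close>

text \<open>
In the variables \<open>x = u + v\<close> and \<open>y = u - v\<close> this is Burkholder's function \<open>y\<^sup>2 - x\<^sup>2\<close> for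
\<open>\<bar>x\<bar> + \<bar>y\<bar> \<le> 1\<close> and \<open>1 - 2\<bar>x\<bar>\<close> otherwise.
\<close>

definition weak_type_function :: "real \<Rightarrow> real \<Rightarrow> real" where
  "weak_type_function u v =
     (if \<bar>u\<bar> \<le> 1/2 \<and> \<bar>v\<bar> \<le> 1/2 then - 4 * u * v else 1 - 2 * \<bar>u + v\<bar>)"

lemma weak_type_function_inner:
  "\<bar>u\<bar> \<le> 1/2 \<Longrightarrow> \<bar>v\<bar> \<le> 1/2 \<Longrightarrow> weak_type_function u v = - 4 * (u * v)"
  by (simp add: weak_type_function_def)

lemma weak_type_function_outer:
  assumes "\<bar>u\<bar> > 1/2 \<or> \<bar>v\<bar> > 1/2"
  shows "weak_type_function u v = 1 - 2 * \<bar>u + v\<bar>"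
proof -
  have "\<not> (\<bar>u\<bar> \<le> 1/2 \<and> \<bar>v\<bar> \<le> 1/2)" using assms by linarith
  then show ?thesis unfolding weak_type_function_def by (rule if_not_P)
qed

text \<open>
With one variable in \<open>[-1/2, 1/2]\<close> fixed, the function is the minimum of three affine functions. With that
variable fixed outside this interval, two of them remain.
\<close>

lemma weak_type_function_concave: "separately_concave weak_type_function"
proof (rule separately_concave_symmetric)
  show "weak_type_function u v = weak_type_function v u" for u v
    unfolding weak_type_function_def by (simp add: add.commute conj_commute)
  fix v :: real
  let ?a = "\<lambda>u. min ((1 - 2 * v) + (- 2) * u) ((1 + 2 * v) + 2 * u)"
  have a: "concave_on UNIV ?a" by (intro concave_on_min concave_on_UNIV_affine)
  have b: "concave_on UNIV (\<lambda>u. min (0 + (- 4 * v) * u) (?a u))"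
    by (intro concave_on_min concave_on_UNIV_affine)
  have abs: "1 - 2 * \<bar>u + v\<bar> = ?a u" for u
    by (cases "0 \<le> u + v") (simp_all add: min_def)
  show "concave_on UNIV (\<lambda>u. weak_type_function u v)"
  proof (cases "\<bar>v\<bar> \<le> 1/2")
    case v: True
    have "weak_type_function u v = min (0 + (- 4 * v) * u) (?a u)" for u
    proof -
      \<comment> \<open>the affine functions differ by \<open>(1 - 2u)(1 - 2v)\<close> and \<open>(1 + 2u)(1 + 2v)\<close>\<close>
      have 1: "(1 - 2 * u) * (1 - 2 * v) = (1 - 2 * v) + (- 2) * u + 4 * (u * v)"
        "(1 + 2 * u) * (1 + 2 * v) = (1 + 2 * v) + 2 * u + 4 * (u * v)"
        by (simp_all add: algebra_simps)
      have 2: "0 + (- 4 * v) * u = - 4 * (u * v)" by simp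
      have v': "1 - 2 * v \<ge> 0" "1 + 2 * v \<ge> 0" using v by auto
      consider "\<bar>u\<bar> \<le> 1/2" | "u > 1/2" | "u < -1/2" by linarith
      then show ?thesis
      proof cases
        case u: 1
        then have "(1 - 2 * u) * (1 - 2 * v) \<ge> 0" "(1 + 2 * u) * (1 + 2 * v) \<ge> 0"
          using v' by (auto intro!: mult_nonneg_nonneg)
        then have "- 4 * (u * v) \<le> ?a u" using 1 by (intro min.boundedI) linarith+
        then show ?thesis unfolding 2 weak_type_function_inner[OF u v] by simp
      next
        case u: 2
        then have "(1 - 2 * u) * (1 - 2 * v) \<le> 0"
          using v' by (intro mult_nonpos_nonneg) auto
        then have "?a u \<le> - 4 * (u * v)" using 1 by (intro min.coboundedI1) linarith
        moreover have "weak_type_function u v = ?a u"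
          unfolding abs[symmetric] using u by (intro weak_type_function_outer) linarith
        ultimately show ?thesis unfolding 2 by simp
      next
        case u: 3
        then have "(1 + 2 * u) * (1 + 2 * v) \<le> 0"
          using v' by (intro mult_nonpos_nonneg) auto
        then have "?a u \<le> - 4 * (u * v)" using 1 by (intro min.coboundedI2) linarith
        moreover have "weak_type_function u v = ?a u"
          unfolding abs[symmetric] using u by (intro weak_type_function_outer) linarith
        ultimately show ?thesis unfolding 2 by simp
      qed
    qed
    with b show ?thesis by presburger
  next
    case False
    then have "weak_type_function u v = ?a u" for u
      unfolding abs[symmetric] by (intro weak_type_function_outer) linarith
    with a show ?thesis by presburger
  qed
qed

lemma weak_type_function_majorizes:
  "(if \<bar>u\<bar> \<ge> 1/2 then 1 else 0) \<le> weak_type_function u v + 2 * \<bar>u + v\<bar>"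
proof (cases "\<bar>u\<bar> \<le> 1/2 \<and> \<bar>v\<bar> \<le> 1/2")
  case False
  then have "weak_type_function u v = 1 - 2 * \<bar>u + v\<bar>" by (intro weak_type_function_outer) linarith
  then show ?thesis by simp
next
  case True
  then have uv: "\<bar>u\<bar> \<le> 1/2" "\<bar>v\<bar> \<le> 1/2" by auto
  show ?thesis
  proof (cases "\<bar>u\<bar> \<ge> 1/2")
    case True
    with uv have "u = 1/2 \<or> u = -1/2" by linarith
    then have "0 \<le> - 4 * (u * v) + 2 * \<bar>u + v\<bar> - 1"
    proof
      assume u: "u = 1/2"
      have "\<bar>1/2 + v\<bar> = 1/2 + v" using uv by simp
      then show ?thesis unfolding u by simp
    next
      assume u: "u = -1/2"
      have "\<bar>- 1/2 + v\<bar> = 1/2 - v" using uv by simp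
      then show ?thesis unfolding u by simp
    qed
    then show ?thesis unfolding weak_type_function_inner[OF uv] by simp
  next
    case False
    have "0 \<le> - 4 * (u * v) + 2 * \<bar>u + v\<bar>"
    proof (cases "u * v \<le> 0")
      case False
      then have "\<bar>u + v\<bar> = \<bar>u\<bar> + \<bar>v\<bar>" by (auto simp: not_le zero_less_mult_iff)
      moreover have "\<bar>u\<bar> * \<bar>v\<bar> \<le> \<bar>u\<bar> * (1/2)" by (intro mult_left_mono uv) simp
      moreover have "u * v = \<bar>u\<bar> * \<bar>v\<bar>" using False by (simp flip: abs_mult)
      ultimately show ?thesis using abs_ge_zero[of v] by linarith
    qed simp
    with False show ?thesis by (simp add: weak_type_function_inner[OF uv])
  qed
qed

lemma weak_type_function_small:
  assumes "\<bar>u\<bar> \<le> M" "\<bar>v\<bar> \<le> M" "M \<le> 1/2"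
  shows "weak_type_function u v \<le> 4 * M powr 2"
proof -
  have M: "M \<ge> 0" using assms by linarith
  have "- (u * v) \<le> \<bar>u\<bar> * \<bar>v\<bar>" by (simp flip: abs_mult)
  also have "\<dots> \<le> M * M" using assms M by (intro mult_mono) auto
  finally show ?thesis using assms M by (subst weak_type_function_inner) (auto simp: power2_eq_square)
qed

text \<open>
Up to a factor this is Burkholder's function \<open>(\<bar>y\<bar> - (p* - 1) \<bar>x\<bar>) (\<bar>x\<bar> + \<bar>y\<bar>) powr (p - 1)\<close> in the variables
\<open>x = u + v\<close> and \<open>y = u - v\<close>, where \<open>p* = max p (p / (p - 1))\<close>. In the variables \<open>u\<close> and \<open>v\<close> a single formula
serves both \<open>p \<le> 2\<close> and \<open>p \<ge> 2\<close>. For \<open>p = 2\<close> it is the bilinear function \<open>- 2 u v\<close>.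
\<close>

definition strong_type_function :: "real \<Rightarrow> real \<Rightarrow> real \<Rightarrow> real" where
  "strong_type_function p u v =
     - \<bar>p - 2\<bar> * max \<bar>u\<bar> \<bar>v\<bar> powr p - p * max \<bar>u\<bar> \<bar>v\<bar> powr (p - 2) * (u * v)"

lemma strong_type_function_sym: "strong_type_function p u v = strong_type_function p v u"
  by (simp add: strong_type_function_def max.commute mult.commute)

lemma strong_type_function_minus: "strong_type_function p (- u) (- v) = strong_type_function p u v"
  by (simp add: strong_type_function_def)

lemma strong_type_function_outer:
  assumes "\<bar>v\<bar> \<le> \<bar>u\<bar>"
  shows "strong_type_function p u v
    = - \<bar>p - 2\<bar> * \<bar>u\<bar> powr p - p * (sgn u * v) * \<bar>u\<bar> powr (p - 1)"
proof -
  have max: "max \<bar>u\<bar> \<bar>v\<bar> = \<bar>u\<bar>" using assms by (rule max_absorb1)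
  have "p * \<bar>u\<bar> powr (p - 2) * (u * v) = p * (sgn u * v) * (\<bar>u\<bar> * \<bar>u\<bar> powr (p - 2))"
    by (simp add: sgn_real_def)
  also have "\<dots> = p * (sgn u * v) * \<bar>u\<bar> powr (p - 1)"
    by (subst powr_mult_base) (auto simp: add.commute)
  finally show ?thesis unfolding strong_type_function_def max by simp
qed

text \<open>
For fixed \<open>v\<close> the function is affine in \<open>u\<close> on \<open>[- v, v]\<close> and smooth on the two outer branches. On these, the sign of
the second derivative is that of \<open>- (\<bar>p - 2\<bar> \<bar>u\<bar> \<plusminus> (p - 2) v)\<close>, which is nonpositive as \<open>v \<le> \<bar>u\<bar>\<close>. The
coefficient \<open>\<bar>p - 2\<bar>\<close> also keeps the slope from increasing at the gluing points.
\<close>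

lemma strong_type_function_concave_nonneg:
  fixes v p :: real
  assumes p: "p > 1" and v: "v \<ge> 0"
  shows "concave_on UNIV (\<lambda>u. strong_type_function p u v)"
proof -
  define k where "k = \<bar>p - 2\<bar>"
  \<comment> \<open>\<open>h 1\<close> and \<open>h (-1)\<close> are the slopes, up to sign, on the outer branches \<open>u > v\<close> and \<open>u < - v\<close>\<close>
  define h where "h e t = k * p * t powr (p - 1) + e * p * (p - 1) * v * t powr (p - 2)"
    for e t :: real
  define f' where "f' u = (if u > v then - h 1 u else if u < - v then h (-1) (- u)
    else - p * v powr (p - 1))" for u
  have h_mono: "h e s \<le> h e t" if "v \<le> s" "s \<le> t" "0 < s" "\<bar>e\<bar> = 1" for e s t
  proof (rule DERIV_nonneg_imp_nondecreasing[OF that(2)])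
    fix x assume x: "s \<le> x" "x \<le> t"
    have "x > 0" using x that by simp
    have "(h e has_real_derivative k * p * ((p - 1) * x powr (p - 1 - 1))
        + e * p * (p - 1) * v * ((p - 2) * x powr (p - 2 - 1))) (at x)"
      unfolding h_def
      by (intro DERIV_add DERIV_cmult has_real_derivative_powr \<open>x > 0\<close>)
    also have "k * p * ((p - 1) * x powr (p - 1 - 1)) = k * p * ((p - 1) * (x * x powr (p - 2 - 1)))"
      by (subst powr_mult_base) (use \<open>x > 0\<close> in auto)
    also have "\<dots> + e * p * (p - 1) * v * ((p - 2) * x powr (p - 2 - 1))
        = p * (p - 1) * x powr (p - 2 - 1) * (k * x + e * (p - 2) * v)"
      by (simp only: algebra_simps)
    finally have "(h e has_real_derivative
        p * (p - 1) * x powr (p - 2 - 1) * (k * x + e * (p - 2) * v)) (at x)" .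
    moreover have "0 \<le> k * x + e * (p - 2) * v"
    proof -
      have "\<bar>e * (p - 2) * v\<bar> = k * v" using that v by (simp add: abs_mult k_def)
      also have "\<dots> \<le> k * x" using x that by (intro mult_left_mono) (auto simp: k_def)
      finally show ?thesis by linarith
    qed
    then have "0 \<le> p * (p - 1) * x powr (p - 2 - 1) * (k * x + e * (p - 2) * v)"
      using p by (intro mult_nonneg_nonneg) auto
    ultimately show "\<exists>y. (h e has_real_derivative y) (at x) \<and> 0 \<le> y" by blast
  qed
  have vpow: "v * v powr (p - 2) = v powr (p - 1)"
    using powr_mult_base[OF v, of "p - 2"] by (simp add: add.commute)
  have h_v: "h e v = p * v powr (p - 1) * (k + e * (p - 1))" for e
    unfolding h_def vpow[symmetric] by (simp add: algebra_simps)
  have h_ge: "h e t \<ge> e * p * v powr (p - 1)" if "t > v" "\<bar>e\<bar> = 1" for t e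
  proof (cases "v = 0")
    case False
    have "e \<le> k + e * (p - 1)" using that(2) p by (auto simp: k_def abs_if split: if_splits)
    then have "p * v powr (p - 1) * e \<le> p * v powr (p - 1) * (k + e * (p - 1))"
      using p by (intro mult_left_mono) auto
    also have "\<dots> \<le> h e t" unfolding h_v[symmetric] using that False v by (intro h_mono) auto
    finally show ?thesis by (simp add: mult_ac)
  qed (use p in \<open>simp add: h_def k_def\<close>)
  have anti: "antimono f'"
  proof (rule antimonoI)
    fix x y :: real assume xy: "x \<le> y"
    have f'_mid: "f' z = - p * v powr (p - 1)" if "\<bar>z\<bar> \<le> v" for z
      using that v by (auto simp: f'_def)
    have f'_up: "f' z = - h 1 z" if "z > v" for z using that by (simp add: f'_def)
    have f'_low: "f' z = h (-1) (- z)" if "z < - v" for z using that v by (auto simp: f'_def)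
    consider "x > v" | "\<bar>x\<bar> \<le> v" "y > v" | "\<bar>x\<bar> \<le> v" "\<bar>y\<bar> \<le> v" | "x < - v" "y < - v"
      | "x < - v" "\<bar>y\<bar> \<le> v" | "x < - v" "y > v" using xy by linarith
    then show "f' y \<le> f' x"
    proof cases
      case 1
      then show ?thesis using xy v h_mono[of x y 1] by (simp add: f'_up)
    next
      case 2
      then show ?thesis using h_ge[of y 1] by (simp add: f'_up f'_mid)
    next
      case 3
      then show ?thesis by (simp add: f'_mid)
    next
      case 4
      then show ?thesis using xy v h_mono[of "- y" "- x" "-1"] by (simp add: f'_low)
    next
      case 5
      then show ?thesis using h_ge[of "- x" "-1"] by (simp add: f'_low f'_mid)
    next
      case 6
      have "- h 1 y \<le> - (p * v powr (p - 1))" using h_ge[of y 1] 6 by simp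
      also have "\<dots> \<le> h (-1) (- x)" using h_ge[of "- x" "-1"] 6 by simp
      finally show ?thesis using 6 by (simp add: f'_up f'_low)
    qed
  qed
  have outer: "((\<lambda>t. - k * t powr p - p * c * t powr (p - 1)) has_real_derivative
      - k * (p * t powr (p - 1)) - p * c * ((p - 1) * t powr (p - 1 - 1))) (at t)"
    if "t > 0" for c t :: real
    by (intro DERIV_diff DERIV_cmult has_real_derivative_powr that)
  have deriv: "((\<lambda>u. strong_type_function p u v) has_real_derivative f' u) (at u)"
    if u: "u \<notin> {v, - v}" for u
  proof -
    consider "u > v" | "u < - v" | "\<bar>u\<bar> < v" using u by force
    then show ?thesis
    proof cases
      case 1
      have "f' u = - k * (p * u powr (p - 1)) - p * v * ((p - 1) * u powr (p - 1 - 1))"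
        using 1 by (simp add: f'_def h_def algebra_simps)
      with 1 v outer[of u v]
      have "((\<lambda>t. - k * t powr p - p * v * t powr (p - 1)) has_real_derivative f' u) (at u)" by simp
      then show ?thesis
        by (rule has_field_derivative_transform_within_open[where S = "{v<..}"])
          (use 1 v in \<open>auto simp: strong_type_function_outer k_def\<close>)
    next
      case 2
      have "- f' u = - k * (p * (-u) powr (p - 1)) - p * (-v) * ((p - 1) * (-u) powr (p - 1 - 1))"
        using 2 v by (simp add: f'_def h_def algebra_simps)
      with 2 v outer[of "-u" "-v"]
      have "((\<lambda>t. - k * t powr p - p * (-v) * t powr (p - 1)) has_real_derivative - f' u) (at (- u))"
        by simp
      then have "((\<lambda>t. - k * (-t) powr p - p * (-v) * (-t) powr (p - 1)) has_real_derivative f' u) (at u)"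
        unfolding DERIV_mirror by simp
      then show ?thesis
        by (rule has_field_derivative_transform_within_open[where S = "{..<-v}"])
          (use 2 v in \<open>auto simp: strong_type_function_outer k_def\<close>)
    next
      case 3
      have "((\<lambda>u. - k * v powr p - p * v powr (p - 1) * u) has_real_derivative f' u) (at u)"
        using 3 by (auto intro!: derivative_eq_intros simp: f'_def)
      then show ?thesis
      proof (rule has_field_derivative_transform_within_open[where S = "{-v<..<v}"])
        fix t assume "t \<in> {-v<..<v}"
        then have "\<bar>t\<bar> \<le> \<bar>v\<bar>" "sgn v = 1" by auto
        then show "- k * v powr p - p * v powr (p - 1) * t = strong_type_function p t v"
          using v by (subst strong_type_function_sym) (simp add: strong_type_function_outer k_def)
      qed (use 3 in auto)
    qed
  qed
  have cont: "continuous_on UNIV (\<lambda>u. strong_type_function p u v)"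
  proof -
    have max: "continuous_on UNIV (\<lambda>u::real. max \<bar>u\<bar> \<bar>v\<bar>)" by (intro continuous_intros)
    have "continuous_on UNIV (\<lambda>u. max \<bar>u\<bar> \<bar>v\<bar> powr p)"
      by (rule continuous_on_powr'[OF max continuous_on_const]) (use p in auto)
    moreover have "continuous_on UNIV (\<lambda>u. max \<bar>u\<bar> \<bar>v\<bar> powr (p - 2) * (u * v))"
    proof (cases "v = 0")
      case False
      have "continuous_on UNIV (\<lambda>u. max \<bar>u\<bar> \<bar>v\<bar> powr (p - 2))"
      proof (rule continuous_on_powr[OF max continuous_on_const])
        show "\<forall>u\<in>UNIV. max \<bar>u\<bar> \<bar>v\<bar> \<noteq> 0" using False by (auto simp: max_def)
      qed
      then show ?thesis by (rule continuous_on_mult) (intro continuous_intros)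
    qed simp
    ultimately show ?thesis
      unfolding strong_type_function_def mult.assoc by (intro continuous_on_diff continuous_on_mult_left)
  qed
  show ?thesis
    by (rule concave_on_UNIV_antimono_derivative[of "{v, - v}", OF _ cont deriv anti]) auto
qed

lemma strong_type_function_concave:
  assumes "p > 1"
  shows "separately_concave (strong_type_function p)"
proof (rule separately_concave_symmetric)
  fix v
  show "concave_on UNIV (\<lambda>u. strong_type_function p u v)"
  proof (cases "v \<ge> 0")
    case False
    then have "concave_on UNIV (\<lambda>u. strong_type_function p (- u) (- v))"
      using concave_on_UNIV_reflect[OF strong_type_function_concave_nonneg[OF assms, of "- v"]] by simp
    then show ?thesis by (simp only: strong_type_function_minus)
  qed (use strong_type_function_concave_nonneg assms in blast)
qed (rule strong_type_function_sym)

text \<open>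
On the line \<open>u + v = 0\<close> the function equals \<open>k \<bar>u\<bar> powr p\<close> with \<open>k = p - \<bar>p - 2\<bar> > 0\<close>. Near that line half of
this survives. Away from it \<open>\<bar>u\<bar>\<close> and \<open>\<bar>v\<bar>\<close> are at most a multiple of \<open>\<bar>u + v\<bar>\<close>, and the last term dominates.
\<close>

lemma strong_type_function_majorizes:
  fixes p u v :: real
  defines "k \<equiv> p - \<bar>p - 2\<bar>"
  assumes p: "p > 1"
  shows "k / 2 * \<bar>u\<bar> powr p
    \<le> strong_type_function p u v + p * (2 * p / k) powr (p - 1) * \<bar>u + v\<bar> powr p"
proof -
  have k: "k > 0" using p by (auto simp: k_def)
  have *: "k / 2 * \<bar>a\<bar> powr p
    \<le> strong_type_function p a b + p * (2 * p / k) powr (p - 1) * \<bar>a + b\<bar> powr p"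
    if ab: "\<bar>b\<bar> \<le> \<bar>a\<bar>" for a b
  proof -
    define s where "s = a + b"
    have "sgn a * b = sgn a * s - \<bar>a\<bar>" by (simp add: s_def algebra_simps abs_sgn)
    moreover have "sgn a * s \<le> \<bar>s\<bar>" by (auto simp: sgn_real_def)
    ultimately have "sgn a * b \<le> \<bar>s\<bar> - \<bar>a\<bar>" by linarith
    then have "p * (sgn a * b) * \<bar>a\<bar> powr (p - 1) \<le> p * (\<bar>s\<bar> - \<bar>a\<bar>) * \<bar>a\<bar> powr (p - 1)"
      using p by (intro mult_right_mono mult_left_mono) auto
    moreover have "\<bar>a\<bar> * \<bar>a\<bar> powr (p - 1) = \<bar>a\<bar> powr p"
      by (subst powr_mult_base) auto
    ultimately have W: "strong_type_function p a b \<ge> k * \<bar>a\<bar> powr p - p * \<bar>s\<bar> * \<bar>a\<bar> powr (p - 1)"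
      unfolding strong_type_function_outer[OF ab] k_def by (simp add: algebra_simps)
    have eq: "\<bar>s\<bar> * \<bar>s\<bar> powr (p - 1) = \<bar>s\<bar> powr p"
      by (subst powr_mult_base) auto
    show ?thesis
    proof (cases "p * \<bar>s\<bar> \<le> k / 2 * \<bar>a\<bar>")
      case True
      then have "p * \<bar>s\<bar> * \<bar>a\<bar> powr (p - 1) \<le> k / 2 * \<bar>a\<bar> * \<bar>a\<bar> powr (p - 1)"
        by (rule mult_right_mono) simp
      also have "\<dots> = k / 2 * \<bar>a\<bar> powr p" using \<open>\<bar>a\<bar> * _ = _\<close> by (simp only: mult.assoc)
      finally have "k / 2 * \<bar>a\<bar> powr p \<le> strong_type_function p a b" using W by linarith
      moreover have "0 \<le> p * (2 * p / k) powr (p - 1) * \<bar>a + b\<bar> powr p" using p by simp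
      ultimately show ?thesis by linarith
    next
      case False
      then have "\<bar>a\<bar> \<le> 2 * p / k * \<bar>s\<bar>" using k by (simp add: field_simps)
      then have "\<bar>a\<bar> powr (p - 1) \<le> (2 * p / k * \<bar>s\<bar>) powr (p - 1)"
        using p by (intro powr_mono2) auto
      also have "\<dots> = (2 * p / k) powr (p - 1) * \<bar>s\<bar> powr (p - 1)"
        by (rule powr_mult)
      finally have "p * \<bar>s\<bar> * \<bar>a\<bar> powr (p - 1) \<le> p * \<bar>s\<bar> * ((2 * p / k) powr (p - 1) * \<bar>s\<bar> powr (p - 1))"
        using p by (intro mult_left_mono) auto
      also have "\<dots> = p * (2 * p / k) powr (p - 1) * (\<bar>s\<bar> * \<bar>s\<bar> powr (p - 1))" by simp
      finally have "p * \<bar>s\<bar> * \<bar>a\<bar> powr (p - 1) \<le> p * (2 * p / k) powr (p - 1) * \<bar>s\<bar> powr p"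
        unfolding eq .
      moreover have "k / 2 * \<bar>a\<bar> powr p \<le> k * \<bar>a\<bar> powr p" using k by simp
      ultimately show ?thesis using W by (simp add: s_def)
    qed
  qed
  show ?thesis
  proof (cases "\<bar>v\<bar> \<le> \<bar>u\<bar>")
    case True
    then show ?thesis by (rule *)
  next
    case False
    then have "k / 2 * \<bar>u\<bar> powr p \<le> k / 2 * \<bar>v\<bar> powr p"
      using p k by (intro mult_left_mono powr_mono2) auto
    also have "\<dots> \<le> strong_type_function p v u + p * (2 * p / k) powr (p - 1) * \<bar>v + u\<bar> powr p"
      using False by (intro *) simp
    finally show ?thesis by (simp add: strong_type_function_sym[of p v u] add.commute)
  qed
qed

lemma strong_type_function_small:
  assumes p: "p > 1" and "\<bar>u\<bar> \<le> M" "\<bar>v\<bar> \<le> M"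
  shows "strong_type_function p u v \<le> p * M powr p"
proof -
  have *: "strong_type_function p a b \<le> p * M powr p" if ab: "\<bar>b\<bar> \<le> \<bar>a\<bar>" "\<bar>a\<bar> \<le> M" for a b
  proof -
    have "- (sgn a * b) \<le> \<bar>a\<bar>" using ab by (auto simp: sgn_real_def)
    then have "p * (- (sgn a * b)) * \<bar>a\<bar> powr (p - 1) \<le> p * \<bar>a\<bar> * \<bar>a\<bar> powr (p - 1)"
      using p by (intro mult_right_mono mult_left_mono) auto
    also have "\<dots> = p * (\<bar>a\<bar> * \<bar>a\<bar> powr (p - 1))" by simp
    also have "\<bar>a\<bar> * \<bar>a\<bar> powr (p - 1) = \<bar>a\<bar> powr p" by (subst powr_mult_base) auto
    finally have "strong_type_function p a b \<le> p * \<bar>a\<bar> powr p"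
      unfolding strong_type_function_outer[OF ab(1)]
      using mult_nonneg_nonneg[of "\<bar>p - 2\<bar>" "\<bar>a\<bar> powr p"] by (simp del: mult_nonneg_nonneg)
    also have "\<dots> \<le> p * M powr p" using p ab by (intro mult_left_mono powr_mono2) auto
    finally show ?thesis .
  qed
  show ?thesis
  proof (cases "\<bar>v\<bar> \<le> \<bar>u\<bar>")
    case False
    then show ?thesis using *[of u v] assms by (simp add: strong_type_function_sym[of p u v])
  qed (use * assms in auto)
qed

section \<open>Sectors and their masses\<close>

text \<open>
A tree with a root at infinity is recorded by its predecessor map and its level function. Confluence replaces the
reference to a boundary point, and sectors are sets of descendants.
\<close>

locale flow_tree =
  fixes pr :: "'a \<Rightarrow> 'a" and lev :: "'a \<Rightarrow> int" and m :: "'a \<Rightarrow> real" and \<sigma> :: "int \<Rightarrow> real"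
    and r :: 'a
  assumes lev_pr: "lev (pr x) = lev x + 1"
    and finite_children: "finite {y. pr y = x}"
    and confluent: "\<exists>n k. (pr ^^ n) x = (pr ^^ k) y"
    and m_pos: "m x > 0"
    and m_flow: "m x = (\<Sum>y | pr y = x. m y)"
    and \<sigma>_pos: "\<sigma> n > 0"
    and \<sigma>_summable: "\<sigma> summable_on {..k}"
    and summable_root: "summable (\<lambda>n. 1 / (\<sigma> (lev ((pr ^^ n) r)) * m ((pr ^^ n) r)))"
begin

abbreviation anc :: "nat \<Rightarrow> 'a \<Rightarrow> 'a" where "anc n \<equiv> pr ^^ n"

definition S :: "int \<Rightarrow> real" where "S j = (\<Sum>k. \<sigma> (j - int k))"

lemma summable_\<sigma>: "summable (\<lambda>k. \<sigma> (j - int k))"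
proof -
  have "range (\<lambda>k. j - int k) = {..j}"
  proof (intro set_eqI iffI)
    fix i assume "i \<in> {..j}"
    then have "i = j - int (nat (j - i))" by simp
    then show "i \<in> range (\<lambda>k. j - int k)" by blast
  qed auto
  moreover have "inj (\<lambda>k. j - int k)" by (auto intro: injI)
  ultimately have "(\<sigma> \<circ> (\<lambda>k. j - int k)) summable_on UNIV"
    using \<sigma>_summable[of j] summable_on_reindex[of "\<lambda>k. j - int k" UNIV \<sigma>] by simp
  then show ?thesis by (auto simp: o_def dest: summable_on_imp_summable)
qed

lemma S_rec: "S j = \<sigma> j + S (j - 1)"
  using suminf_split_head[OF summable_\<sigma>[of j]] by (simp add: S_def algebra_simps)

lemma S_pos: "S j > 0"
  unfolding S_def by (rule suminf_pos[OF summable_\<sigma>]) (rule \<sigma>_pos)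

lemma S_step: "S j \<le> S (j + 1)"
  using S_rec[of "j + 1"] \<sigma>_pos[of "j + 1"] by simp

lemma S_mono_nat: "S j \<le> S (j + int n)"
proof (induction n)
  case (Suc n)
  with S_step[of "j + int n"] show ?case by (simp add: add.assoc add.commute[of 1])
qed simp

text \<open>
The three weights are the measures of \<open>{x}\<close>, of the sector of \<open>x\<close> and of the punctured sector of \<open>x\<close>. The last
two are given by closed formulas, which are valid by the flow property.
\<close>

definition mu :: "'a \<Rightarrow> real" where "mu x = m x * \<sigma> (lev x)"
definition tau :: "'a \<Rightarrow> real" where "tau x = m x * S (lev x)"
definition tau' :: "'a \<Rightarrow> real" where "tau' x = m x * S (lev x - 1)"

lemma mu_pos: "mu x > 0" and tau_pos: "tau x > 0" and tau'_pos: "tau' x > 0"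
  using m_pos \<sigma>_pos S_pos by (simp_all add: mu_def tau_def tau'_def)

lemma tau_split: "tau x = mu x + tau' x"
  unfolding tau_def mu_def tau'_def S_rec[of "lev x"] by (simp add: algebra_simps)

lemma tau'_split: "tau' x = (\<Sum>y | pr y = x. tau y)"
proof -
  have "(\<Sum>y | pr y = x. tau y) = (\<Sum>y | pr y = x. m y * S (lev x - 1))"
    by (rule sum.cong) (auto simp: tau_def lev_pr)
  then show ?thesis by (simp add: tau'_def m_flow[of x] sum_distrib_right)
qed

lemma m_le_pr: "m x \<le> m (pr x)"
  unfolding m_flow[of "pr x"]
  by (rule member_le_sum) (use m_pos in \<open>auto intro: less_imp_le finite_children\<close>)

lemma tau_le_tau'_pr: "tau x \<le> tau' (pr x)"
  unfolding tau_def tau'_def lev_pr using m_le_pr S_pos[of "lev x"] by (simp add: mult_right_mono)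

lemma lev_anc: "lev (anc n x) = lev x + int n"
  by (induction n) (auto simp: lev_pr)

lemma anc_Suc: "anc (Suc n) x = anc n (pr x)"
  by (simp add: funpow_swap1)

lemma anc_add: "anc (a + b) x = anc a (anc b x)"
  by (simp add: funpow_add)

text \<open>
The mass of a sector is at least that of its top vertex, which gives the claim for the reference vertex. Any
other vertex shares all but finitely many of its ancestors with the reference vertex.
\<close>

lemma summable_inverse_tau: "summable (\<lambda>n. 1 / tau (anc n x))"
proof -
  obtain a b where ab: "anc a x = anc b r" using confluent by blast
  have root: "summable (\<lambda>n. 1 / tau (anc n r))"
  proof (rule summable_comparison_test'[OF summable_root])
    fix n
    let ?v = "anc n r"
    have "\<sigma> (lev ?v) * m ?v \<le> tau ?v"
      using tau_split[of ?v] tau'_pos[of ?v] by (simp add: mu_def mult.commute)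
    then show "norm (1 / tau ?v) \<le> 1 / (\<sigma> (lev ?v) * m ?v)"
      using tau_pos[of ?v] \<sigma>_pos m_pos by (simp add: frac_le)
  qed
  have "1 / tau (anc (n + a) x) = 1 / tau (anc (n + b) r)" for n
    by (simp add: anc_add ab)
  then have "summable (\<lambda>n. 1 / tau (anc (n + a) x))"
    using summable_ignore_initial_segment[OF root, of b] by simp
  then show ?thesis using summable_iff_shift[of "\<lambda>n. 1 / tau (anc n x)" a] by simp
qed

lemma tau_anc_at_top: "filterlim (\<lambda>n. tau (anc n x)) at_top sequentially"
proof -
  have "(\<lambda>n. inverse (tau (anc n x))) \<longlonglongrightarrow> 0"
    using summable_LIMSEQ_zero[OF summable_inverse_tau[of x]] by (simp add: inverse_eq_divide)
  then have "filterlim (\<lambda>n. inverse (inverse (tau (anc n x)))) at_top sequentially"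
    by (rule filterlim_inverse_at_top) (simp add: tau_pos)
  then show ?thesis by simp
qed

definition T :: "'a \<Rightarrow> 'a set" where "T x = {y. \<exists>n. anc n y = x}"

lemma T_level: "z \<in> T x \<longleftrightarrow> lev z \<le> lev x \<and> anc (nat (lev x - lev z)) z = x"
proof
  assume "z \<in> T x"
  then obtain n where "anc n z = x" by (auto simp: T_def)
  then have "lev x = lev z + int n" using lev_anc by metis
  with \<open>anc n z = x\<close> show "lev z \<le> lev x \<and> anc (nat (lev x - lev z)) z = x" by simp
qed (auto simp: T_def)

lemma T_refl: "x \<in> T x" by (auto simp: T_def intro: exI[of _ 0])

lemma T_pr: "z \<in> T x \<Longrightarrow> z \<in> T (pr x)"
  by (auto simp: T_def intro: exI[of _ "Suc _"])

lemma T_lev_le: "z \<in> T x \<Longrightarrow> lev z \<le> lev x"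
  by (simp add: T_level)

lemma T_same_level: "z \<in> T x \<Longrightarrow> z \<in> T y \<Longrightarrow> lev x = lev y \<Longrightarrow> x = y"
  by (metis T_level)

lemma T_anc: "z \<in> T x \<Longrightarrow> z \<in> T (anc n x)"
  by (induction n) (auto intro: T_pr)

lemma self_in_T_anc: "x \<in> T (anc n x)"
  by (auto simp: T_def)

lemma punctured_T: "T x - {x} = (\<Union>y\<in>{y. pr y = x}. T y)"
proof (intro set_eqI iffI)
  fix z assume z: "z \<in> T x - {x}"
  then obtain n where n: "anc n z = x" by (auto simp: T_def)
  with z have "n \<noteq> 0" by (cases n) auto
  then obtain k where "n = Suc k" by (cases n) auto
  with n have "pr (anc k z) = x" by simp
  then show "z \<in> (\<Union>y\<in>{y. pr y = x}. T y)" by (auto intro: self_in_T_anc)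
next
  fix z assume "z \<in> (\<Union>y\<in>{y. pr y = x}. T y)"
  then obtain y where y: "pr y = x" "z \<in> T y" by auto
  then have "lev z < lev x" using T_lev_le[of z y] lev_pr[of y] by simp
  then show "z \<in> T x - {x}" using T_pr y by auto
qed

lemma sum_punctured_T:
  assumes "finite A"
  shows "(\<Sum>z\<in>A \<inter> (T x - {x}). h z) = (\<Sum>y | pr y = x. \<Sum>z\<in>A \<inter> T y. h z)"
  unfolding punctured_T Int_UN_distrib
proof (rule sum.UNION_disjoint)
  have "y = y'" if "pr y = x" "pr y' = x" "z \<in> T y" "z \<in> T y'" for y y' z
    by (rule T_same_level[OF that(3,4)]) (use lev_pr[of y] lev_pr[of y'] that in simp)
  then show "\<forall>i\<in>{y. pr y = x}. \<forall>j\<in>{y. pr y = x}. i \<noteq> j \<longrightarrow> A \<inter> T i \<inter> (A \<inter> T j) = {}"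
    by blast
qed (use assms finite_children in auto)

section \<open>The Bergman kernel\<close>

text \<open>
The \<open>n\<close>-th term of the Bergman kernel, written as the difference of two averaging kernels: over the
sector of \<open>p\<^sup>n(x)\<close> and over the punctured sector of its predecessor.
\<close>

definition kernel_term :: "'a \<Rightarrow> 'a \<Rightarrow> nat \<Rightarrow> real" where
  "kernel_term x z n = of_bool (z \<in> T (anc n x)) / tau (anc n x)
     - of_bool (z \<in> T (anc (Suc n) x) - {anc (Suc n) x}) / tau' (anc (Suc n) x)"

definition K :: "'a \<Rightarrow> 'a \<Rightarrow> real" where "K x z = (\<Sum>n. kernel_term x z n)"

lemma summable_kernel_term: "summable (kernel_term x z)"
proof (rule summable_comparison_test'[OF summable_mult[OF summable_inverse_tau[of x], of 2]])
  fix n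
  have *: "1 / tau' (anc (Suc n) x) \<le> 1 / tau (anc n x)"
    using tau_le_tau'_pr[of "anc n x"] tau_pos[of "anc n x"] by (simp add: frac_le)
  have "norm (kernel_term x z n) \<le> 1 / tau (anc n x) + 1 / tau' (anc (Suc n) x)"
    unfolding kernel_term_def
    using tau_pos[of "anc n x"] tau'_pos[of "anc (Suc n) x"]
    by (intro order_trans[OF norm_triangle_ineq4] add_mono) (auto simp: of_bool_def)
  with * show "norm (kernel_term x z n) \<le> 2 * (1 / tau (anc n x))" by linarith
qed

text \<open>
Passing from a vertex to its successor adds one martingale difference, since the terms of the kernel at \<open>p(y)\<close> are
those at \<open>y\<close> without the first one.
\<close>

lemma K_rec:
  "K y z = K (pr y) z + of_bool (z \<in> T y) / tau y
     - of_bool (z \<in> T (pr y) - {pr y}) / tau' (pr y)"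
proof -
  have "K y z = kernel_term y z 0 + (\<Sum>n. kernel_term y z (Suc n))"
    unfolding K_def using suminf_split_head[OF summable_kernel_term[of y z]] by simp
  also have "(\<lambda>n. kernel_term y z (Suc n)) = kernel_term (pr y) z"
    by (rule ext) (simp only: kernel_term_def anc_Suc)
  finally show ?thesis by (simp add: K_def kernel_term_def)
qed

text \<open>
Every sector containing \<open>x\<close> that occurs in the kernel at \<open>x\<close> also contains the descendants of \<open>x\<close>.
\<close>

lemma K_above: "z \<in> T x \<Longrightarrow> K x z = K x x"
proof -
  assume z: "z \<in> T x"
  have "kernel_term x z = kernel_term x x"
  proof
    fix n
    have "z \<in> T (anc n x)" "z \<in> T (anc (Suc n) x)" using T_anc z by blast+
    moreover have "z \<noteq> anc (Suc n) x" "x \<noteq> anc (Suc n) x"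
      using T_lev_le[OF z] lev_anc[of "Suc n" x] by auto
    ultimately show "kernel_term x z n = kernel_term x x n"
      using self_in_T_anc[of x n] self_in_T_anc[of x "Suc n"] unfolding kernel_term_def by simp
  qed
  then show ?thesis by (simp add: K_def)
qed

text \<open>
The terms are \<open>(1/m(p\<^sup>n x) - 1/m(p\<^sup>(n+1) x)) / S(\<ell>(x) + n)\<close>. They are nonnegative because \<open>m\<close> increases towards the
root, and since \<open>S\<close> increases too, they are dominated by a telescoping series.
\<close>

lemma K_diagonal_bounds: "0 \<le> K x x" "K x x \<le> 1 / tau x"
proof -
  define q where "q n = 1 / m (anc n x)" for n
  have "q (Suc n) \<le> q n" for n
    unfolding q_def using m_le_pr[of "anc n x"] m_pos by (simp add: frac_le)
  then have dec: "0 \<le> q n - q (Suc n)" for n by (simp add: diff_ge_0_iff_ge)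
  have eq: "kernel_term x x n = (q n - q (Suc n)) / S (lev x + int n)" for n
  proof -
    have "x \<noteq> anc (Suc n) x" using lev_anc[of "Suc n" x] by auto
    then have "kernel_term x x n = 1 / tau (anc n x) - 1 / tau' (anc (Suc n) x)"
      using self_in_T_anc[of x n] self_in_T_anc[of x "Suc n"] by (simp add: kernel_term_def)
    also have "tau' (anc (Suc n) x) = m (anc (Suc n) x) * S (lev x + int n)"
      by (simp only: tau'_def lev_anc) simp
    finally show ?thesis by (simp add: tau_def lev_anc q_def diff_divide_distrib)
  qed
  have nonneg: "0 \<le> kernel_term x x n" for n
    unfolding eq using dec[of n] S_pos[of "lev x + int n"] by simp
  then show "0 \<le> K x x" unfolding K_def by (intro suminf_nonneg summable_kernel_term)
  show "K x x \<le> 1 / tau x" unfolding K_def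
  proof (rule suminf_le_const[OF summable_kernel_term])
    fix N
    have "(\<Sum>n<N. kernel_term x x n) \<le> (\<Sum>n<N. (q n - q (Suc n)) / S (lev x))"
      unfolding eq by (intro sum_mono divide_left_mono) (use dec S_pos S_mono_nat in auto)
    also have "\<dots> = (q 0 - q N) / S (lev x)"
      by (simp add: sum_lessThan_telescope' flip: sum_divide_distrib)
    also have "\<dots> \<le> q 0 / S (lev x)"
      using m_pos[of "anc N x"] S_pos[of "lev x"] by (intro divide_right_mono) (auto simp: q_def)
    finally show "(\<Sum>n<N. kernel_term x x n) \<le> 1 / tau x" by (simp add: q_def tau_def)
  qed
qed

text \<open>
The vertex \<open>w\<close> is the lowest common ancestor of \<open>x\<close> and \<open>z\<close>. From \<open>x\<close> up to the successor \<open>y\<close> of \<open>w\<close>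
above \<open>x\<close>, the kernel terms do not see \<open>z\<close>. The step from \<open>y\<close> to \<open>w\<close> subtracts the averaging kernel of the
punctured sector of \<open>w\<close>, and the rest is the kernel at \<open>w\<close>.
\<close>

lemma K_join:
  assumes xw: "x \<in> T w" and zw: "z \<in> T w"
    and join: "\<And>y. pr y = w \<Longrightarrow> \<not> (x \<in> T y \<and> z \<in> T y)"
  shows "K x z = K w w - of_bool (x \<noteq> w \<and> z \<noteq> w) / tau' w"
proof (cases "x = w")
  case True
  then show ?thesis using K_above zw by simp
next
  case False
  with xw have "x \<in> T w - {w}" by simp
  then obtain y where y: "pr y = w" "x \<in> T y" unfolding punctured_T by blast
  with join have zy: "z \<notin> T y" by blast
  obtain n where "anc n x = y" using y(2) by (auto simp: T_def)
  then have "K x z = K y z"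
  proof (induction n arbitrary: x)
    case (Suc n)
    then have n: "anc n (pr x) = y" by (simp only: anc_Suc)
    then have "z \<notin> T (pr x)" using zy T_anc by blast
    moreover from this have "z \<notin> T x" using T_pr by blast
    ultimately show ?case using Suc.IH[OF n] by (simp add: K_rec[of x])
  qed simp
  also have "\<dots> = K w z - of_bool (z \<noteq> w) / tau' w"
    using zy zw by (simp add: K_rec[of y] y(1))
  finally show ?thesis using False K_above[OF zw] by simp
qed

lemma join_exists:
  "\<exists>w. x \<in> T w \<and> z \<in> T w \<and> (\<forall>y. pr y = w \<longrightarrow> \<not> (x \<in> T y \<and> z \<in> T y))"
proof -
  obtain a b where "anc a x = anc b z" using confluent by blast
  then have ex: "z \<in> T (anc a x)" by (simp add: self_in_T_anc)
  define n where "n = (LEAST n. z \<in> T (anc n x))"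
  have n: "z \<in> T (anc n x)" unfolding n_def using ex by (rule LeastI)
  have "\<not> (x \<in> T y \<and> z \<in> T y)" if y: "pr y = anc n x" for y
  proof
    assume xz: "x \<in> T y \<and> z \<in> T y"
    then obtain j where j: "anc j x = y" by (auto simp: T_def)
    have "lev y + 1 = lev x + int n" using lev_pr[of y] lev_anc[of n x] y by simp
    then have "j < n" using lev_anc[of j x] j by simp
    then have "z \<notin> T (anc j x)" unfolding n_def by (rule not_less_Least)
    with xz j show False by simp
  qed
  with n show ?thesis using self_in_T_anc[of x n] by blast
qed

text \<open>
The formula at the lowest common ancestor is symmetric in \<open>x\<close> and \<open>z\<close>.
\<close>

lemma K_sym: "K x z = K z x"
proof -
  obtain w where w: "x \<in> T w" "z \<in> T w" "\<And>y. pr y = w \<Longrightarrow> \<not> (x \<in> T y \<and> z \<in> T y)"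
    using join_exists[of x z] by blast
  then have "K x z = K w w - of_bool (x \<noteq> w \<and> z \<noteq> w) / tau' w" by (rule K_join)
  moreover have "K z x = K w w - of_bool (z \<noteq> w \<and> x \<noteq> w) / tau' w"
    using w by (intro K_join) blast+
  ultimately show ?thesis by (simp add: conj_commute)
qed

section \<open>Estimates for finitely supported functions\<close>

definition generation :: "nat \<Rightarrow> 'a \<Rightarrow> 'a set" where "generation n x = {z. anc n z = x}"

lemma generation_Suc: "generation (Suc n) x = (\<Union>y\<in>generation n x. {z. pr z = y})"
  by (auto simp: generation_def funpow_swap1)

lemma finite_generation: "finite (generation n x)"
proof (induction n)
  case 0
  have "generation 0 x = {x}" by (auto simp: generation_def)
  then show ?case by simp
next
  case (Suc n)
  then show ?case by (simp add: generation_Suc finite_children)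
qed

lemma generation_level: "z \<in> generation n x \<Longrightarrow> lev x = lev z + int n"
  using lev_anc by (auto simp: generation_def)

definition below :: "nat \<Rightarrow> 'a \<Rightarrow> 'a set" where "below N x = (\<Union>n<N. generation n x)"

lemma finite_below: "finite (below N x)"
  by (auto simp: below_def intro: finite_generation)

lemma below_iff: "z \<in> below N x \<longleftrightarrow> z \<in> T x \<and> lev x < lev z + int N"
proof
  assume "z \<in> T x \<and> lev x < lev z + int N"
  then show "z \<in> below N x" unfolding T_level below_def generation_def by auto
qed (auto simp: below_def generation_def T_def lev_anc)

text \<open>
Iterating a one-step inequality down the tree: the total of \<open>\<Phi>\<close> over a generation, plus the \<open>w\<close>-mass collected
on the way, never exceeds the value of \<open>\<Phi>\<close> at the top.
\<close>

lemma superadditive_below: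
  assumes step: "\<And>x. w x + (\<Sum>y | pr y = x. \<Phi> y) \<le> \<Phi> x"
  shows "(\<Sum>z\<in>below N x. w z) + (\<Sum>z\<in>generation N x. \<Phi> z) \<le> (\<Phi> x :: real)"
proof (induction N)
  case 0
  have "generation 0 x = {x}" "below 0 x = {}" by (auto simp: generation_def below_def)
  then show ?case by simp
next
  case (Suc N)
  have "below (Suc N) x = below N x \<union> generation N x" by (auto simp: below_def less_Suc_eq)
  moreover have "below N x \<inter> generation N x = {}" by (auto simp: below_def dest!: generation_level)
  ultimately have b: "(\<Sum>z\<in>below (Suc N) x. w z) = (\<Sum>z\<in>below N x. w z) + (\<Sum>z\<in>generation N x. w z)"
    by (simp add: sum.union_disjoint finite_below finite_generation)
  have g: "(\<Sum>z\<in>generation (Suc N) x. \<Phi> z) = (\<Sum>y\<in>generation N x. \<Sum>z | pr z = y. \<Phi> z)"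
    unfolding generation_Suc by (rule sum.UNION_disjoint) (auto simp: finite_generation finite_children)
  have "(\<Sum>z\<in>generation N x. w z) + (\<Sum>y\<in>generation N x. \<Sum>z | pr z = y. \<Phi> z) \<le> (\<Sum>y\<in>generation N x. \<Phi> y)"
    unfolding sum.distrib[symmetric] by (intro sum_mono step)
  with Suc b g show ?case by linarith
qed

lemma common_ancestor:
  assumes "finite F"
  shows "\<forall>\<^sub>F n in sequentially. F \<subseteq> T (anc n r)"
  using assms
proof (induction F)
  case (insert x F)
  obtain a b where ab: "anc a x = anc b r" using confluent by blast
  have "x \<in> T (anc n r)" if "n \<ge> b" for n
  proof -
    have "anc n r = anc (n - b) (anc a x)" using that by (simp add: ab flip: anc_add)
    then show ?thesis by (auto simp: T_def simp flip: anc_add)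
  qed
  then have "\<forall>\<^sub>F n in sequentially. x \<in> T (anc n r)" by (rule eventually_sequentiallyI)
  with insert.IH show ?case by eventually_elim simp
qed simp

context
  fixes A :: "'a set" and f :: "'a \<Rightarrow> real"
  assumes finA: "finite A"
begin

text \<open>
These are the projection of the function equal to \<open>f\<close> on the finite set \<open>A\<close> and to zero elsewhere, and the averages of
this function over the sector of \<open>x\<close> and over its punctured sector.
\<close>

definition finite_proj :: "'a \<Rightarrow> real" where "finite_proj x = (\<Sum>z\<in>A. K x z * f z * mu z)"
definition average :: "'a \<Rightarrow> real" where "average x = (\<Sum>z\<in>A \<inter> T x. f z * mu z) / tau x"
definition punctured_average :: "'a \<Rightarrow> real" where "punctured_average x = (\<Sum>z\<in>A \<inter> (T x - {x}). f z * mu z) / tau' x"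

lemma finite_proj_rec: "finite_proj y = finite_proj (pr y) + average y - punctured_average (pr y)"
proof -
  have restrict: "(\<Sum>z\<in>A. of_bool (z \<in> B) / c * (f z * mu z)) = (\<Sum>z\<in>A \<inter> B. f z * mu z) / c"
    for B and c :: real
    unfolding sum_divide_distrib
    by (rule sum.mono_neutral_cong_right) (auto simp: finA)
  have "finite_proj y = (\<Sum>z\<in>A. K (pr y) z * f z * mu z + of_bool (z \<in> T y) / tau y * (f z * mu z)
      - of_bool (z \<in> T (pr y) - {pr y}) / tau' (pr y) * (f z * mu z))"
    unfolding finite_proj_def by (subst K_rec) (simp add: algebra_simps)
  then show ?thesis
    unfolding sum_subtractf sum.distrib restrict by (simp only: finite_proj_def average_def punctured_average_def)
qed

lemma average_split: "mu x * (if x \<in> A then f x else 0) + tau' x * punctured_average x = tau x * average x"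
proof -
  have "(\<Sum>z\<in>A \<inter> T x. f z * mu z)
      = (\<Sum>z\<in>A \<inter> (T x - {x}). f z * mu z) + (if x \<in> A then f x else 0) * mu x"
  proof (cases "x \<in> A")
    case True
    then have "A \<inter> T x = insert x (A \<inter> (T x - {x}))" using T_refl by auto
    then show ?thesis using True finA by simp
  next
    case False
    then have "A \<inter> T x = A \<inter> (T x - {x})" by auto
    then show ?thesis using False by simp
  qed
  then show ?thesis using tau_pos[of x] tau'_pos[of x] by (simp add: average_def punctured_average_def)
qed

lemma punctured_average_split: "tau' x * punctured_average x = (\<Sum>y | pr y = x. tau y * average y)"
proof -
  have "tau y * average y = (\<Sum>z\<in>A \<inter> T y. f z * mu z)" for y
    using tau_pos[of y] by (simp add: average_def)
  then show ?thesis
    using tau'_pos[of x] by (simp add: punctured_average_def sum_punctured_T[OF finA])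
qed

text \<open>
Burkholder's concavity argument. When the sector of \<open>x\<close> splits into \<open>{x}\<close> and its punctured sector, the projection stays
constant and only the second variable moves. When the punctured sector splits into the sectors of
the successors, the projection moves by the change of the average, so the second variable stays constant. In both
cases the weighted mean of the moving variable is preserved, and Jensen's inequality applies.
\<close>

lemma zigzag_step:
  assumes W: "separately_concave W"
  shows "mu x * W (finite_proj x) ((if x \<in> A then f x else 0) - finite_proj x)
    + (\<Sum>y | pr y = x. tau y * W (finite_proj y) (average y - finite_proj y)) \<le> tau x * W (finite_proj x) (average x - finite_proj x)"
proof -
  let ?F = "if x \<in> A then f x else 0"
  let ?w = "\<lambda>b. if b then mu x else tau' x" and ?v = "\<lambda>b. (if b then ?F else punctured_average x) - finite_proj x"
  have "(\<Sum>b\<in>UNIV. ?w b * W (finite_proj x) (?v b)) \<le> (\<Sum>b\<in>UNIV. ?w b) * W (finite_proj x) (average x - finite_proj x)"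
  proof (rule weighted_Jensen_concave[where h = "W (finite_proj x)"])
    show "concave_on UNIV (W (finite_proj x))" using W by (simp add: separately_concave_def)
    show "(\<Sum>b\<in>UNIV. ?w b * ?v b) = (\<Sum>b\<in>UNIV. ?w b) * (average x - finite_proj x)"
      using average_split[of x] tau_split[of x] by (simp add: UNIV_bool algebra_simps)
  qed (use mu_pos[of x] tau'_pos[of x] in auto)
  then have 1: "mu x * W (finite_proj x) (?F - finite_proj x) + tau' x * W (finite_proj x) (punctured_average x - finite_proj x)
      \<le> tau x * W (finite_proj x) (average x - finite_proj x)"
    by (simp add: UNIV_bool tau_split add.commute)
  have child_value: "finite_proj y = finite_proj x + average y - punctured_average x" if "pr y = x" for y using finite_proj_rec[of y] that by simp
  have "(\<Sum>y | pr y = x. tau y * W (finite_proj y) (punctured_average x - finite_proj x))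
      \<le> (\<Sum>y | pr y = x. tau y) * W (finite_proj x) (punctured_average x - finite_proj x)"
  proof (rule weighted_Jensen_concave[where h = "\<lambda>u. W u (punctured_average x - finite_proj x)"])
    show "concave_on UNIV (\<lambda>u. W u (punctured_average x - finite_proj x))" using W by (simp add: separately_concave_def)
    have "(\<Sum>y | pr y = x. tau y * finite_proj y) = (\<Sum>y | pr y = x. tau y * (finite_proj x - punctured_average x) + tau y * average y)"
      by (rule sum.cong) (simp_all add: child_value algebra_simps)
    also have "\<dots> = (\<Sum>y | pr y = x. tau y) * (finite_proj x - punctured_average x) + tau' x * punctured_average x"
      by (simp only: sum.distrib sum_distrib_right punctured_average_split)
    finally show "(\<Sum>y | pr y = x. tau y * finite_proj y) = (\<Sum>y | pr y = x. tau y) * finite_proj x"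
      by (simp add: tau'_split algebra_simps)
  qed (use finite_children tau_pos in \<open>auto intro: less_imp_le\<close>)
  moreover have "(\<Sum>y | pr y = x. tau y * W (finite_proj y) (punctured_average x - finite_proj x))
      = (\<Sum>y | pr y = x. tau y * W (finite_proj y) (average y - finite_proj y))"
  proof (rule sum.cong)
    fix y assume "y \<in> {y. pr y = x}"
    then have "punctured_average x - finite_proj x = average y - finite_proj y" using child_value by simp
    then show "tau y * W (finite_proj y) (punctured_average x - finite_proj x) = tau y * W (finite_proj y) (average y - finite_proj y)" by simp
  qed simp
  ultimately show ?thesis using 1 by (simp add: tau'_split)
qed

text \<open>
Above the support of \<open>f\<close> the kernel is constant on the support.
\<close>

lemma top_bounds:
  assumes "A \<subseteq> T x"
  shows "\<bar>finite_proj x\<bar> \<le> (\<Sum>z\<in>A. \<bar>f z\<bar> * mu z) / tau x" "\<bar>average x\<bar> \<le> (\<Sum>z\<in>A. \<bar>f z\<bar> * mu z) / tau x"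
proof -
  let ?s = "\<Sum>z\<in>A. f z * mu z"
  have abs: "\<bar>?s\<bar> \<le> (\<Sum>z\<in>A. \<bar>f z\<bar> * mu z)"
    by (rule order_trans[OF sum_abs]) (simp add: abs_mult abs_of_pos[OF mu_pos])
  have "finite_proj x = (\<Sum>z\<in>A. K x x * (f z * mu z))"
    unfolding finite_proj_def by (rule sum.cong) (use assms K_above in auto)
  then have "\<bar>finite_proj x\<bar> = K x x * \<bar>?s\<bar>"
    using K_diagonal_bounds(1)[of x] by (simp add: abs_mult flip: sum_distrib_left)
  also have "\<dots> \<le> 1 / tau x * (\<Sum>z\<in>A. \<bar>f z\<bar> * mu z)"
    using abs K_diagonal_bounds tau_pos[of x] by (intro mult_mono) auto
  finally show "\<bar>finite_proj x\<bar> \<le> (\<Sum>z\<in>A. \<bar>f z\<bar> * mu z) / tau x" by simp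
  have "A \<inter> T x = A" using assms by auto
  then show "\<bar>average x\<bar> \<le> (\<Sum>z\<in>A. \<bar>f z\<bar> * mu z) / tau x"
    using abs tau_pos[of x] by (simp add: average_def divide_right_mono)
qed

text \<open>
Apart from the sum over the vertices, going down from a high ancestor \<open>t\<close> produces only the total of
\<open>\<Phi>\<close> at the bottom, which is nonnegative, and its value at \<open>t\<close>. As both arguments of \<open>W\<close>
are of order \<open>1 / tau t\<close> there, this value is at most a constant times \<open>tau t powr (1 - q)\<close>, which tends to \<open>0\<close> as
\<open>t\<close> moves up.
\<close>

lemma burkholder_bound:
  assumes W: "separately_concave W"
    and major: "\<And>u v. H u \<le> W u v + G (u + v)"
    and H: "\<And>u. H u \<ge> 0" and G: "G 0 = 0"
    and q: "q > 1" and e: "e > 0"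
    and small: "\<And>u v M. \<bar>u\<bar> \<le> M \<Longrightarrow> \<bar>v\<bar> \<le> M \<Longrightarrow> M \<le> e \<Longrightarrow> W u v \<le> c * M powr q"
    and F: "finite F"
  shows "(\<Sum>x\<in>F. mu x * H (finite_proj x)) \<le> (\<Sum>x\<in>A. mu x * G (f x))"
proof -
  define \<Phi> where "\<Phi> x = tau x * W (finite_proj x) (average x - finite_proj x)" for x
  define fA where "fA x = (if x \<in> A then f x else 0)" for x
  define s where "s = (\<Sum>z\<in>A. \<bar>f z\<bar> * mu z)"
  have s: "s \<ge> 0" unfolding s_def by (intro sum_nonneg) (simp add: less_imp_le[OF mu_pos])
  have le_\<Phi>: "(\<Sum>x\<in>F. mu x * H (finite_proj x)) \<le> (\<Sum>x\<in>A. mu x * G (f x)) + \<Phi> t"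
    if t: "F \<union> A \<subseteq> T t" for t
  proof -
    have "\<forall>z\<in>F \<union> A. \<forall>\<^sub>F N in sequentially. z \<in> below N t"
    proof
      fix z assume "z \<in> F \<union> A"
      with t have "z \<in> below N t" if "N \<ge> nat (lev t - lev z + 1)" for N
        using that unfolding below_iff by auto
      then show "\<forall>\<^sub>F N in sequentially. z \<in> below N t" by (rule eventually_sequentiallyI)
    qed
    then have "\<forall>\<^sub>F N in sequentially. \<forall>z\<in>F \<union> A. z \<in> below N t"
      using F finA by (intro eventually_ball_finite) auto
    then obtain N where N: "F \<union> A \<subseteq> below N t"
      by (auto simp: eventually_sequentially)
    \<comment> \<open>\<open>f\<close> vanishes on the sectors below generation \<open>N\<close>, so the bottom terms are nonnegative\<close>
    have bottom: "0 \<le> \<Phi> z" if z: "z \<in> generation N t" for z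
    proof -
      have "A \<inter> T z = {}"
      proof (rule ccontr)
        assume "A \<inter> T z \<noteq> {}"
        then obtain a where a: "a \<in> A" "a \<in> T z" by auto
        with N have "lev t < lev a + int N" by (auto simp: below_iff)
        with T_lev_le[OF a(2)] generation_level[OF z] show False by simp
      qed
      then have "average z = 0" by (simp add: average_def)
      then have "0 \<le> W (finite_proj z) (average z - finite_proj z)" using major[of "finite_proj z" "average z - finite_proj z"] H[of "finite_proj z"] G by simp
      then show ?thesis using tau_pos[of z] by (simp add: \<Phi>_def)
    qed
    have "(\<Sum>x\<in>F. mu x * H (finite_proj x)) \<le> (\<Sum>x\<in>below N t. mu x * H (finite_proj x))"
      using N H mu_pos by (intro sum_mono2) (auto simp: finite_below less_imp_le)
    also have "\<dots> \<le> (\<Sum>x\<in>below N t. mu x * W (finite_proj x) (fA x - finite_proj x) + mu x * G (fA x))"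
    proof (rule sum_mono)
      fix x
      show "mu x * H (finite_proj x) \<le> mu x * W (finite_proj x) (fA x - finite_proj x) + mu x * G (fA x)"
        using major[of "finite_proj x" "fA x - finite_proj x"] mu_pos[of x]
        by (simp flip: distrib_left)
    qed
    also have "\<dots> = (\<Sum>x\<in>below N t. mu x * W (finite_proj x) (fA x - finite_proj x)) + (\<Sum>x\<in>below N t. mu x * G (fA x))"
      by (rule sum.distrib)
    also have "(\<Sum>x\<in>below N t. mu x * G (fA x)) = (\<Sum>x\<in>A. mu x * G (f x))"
      by (rule sum.mono_neutral_cong_right) (use N in \<open>auto simp: finite_below fA_def G\<close>)
    also have "(\<Sum>x\<in>below N t. mu x * W (finite_proj x) (fA x - finite_proj x)) \<le> \<Phi> t"
    proof -
      have "(\<Sum>x\<in>below N t. mu x * W (finite_proj x) (fA x - finite_proj x)) + (\<Sum>z\<in>generation N t. \<Phi> z) \<le> \<Phi> t"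
        unfolding \<Phi>_def fA_def by (rule superadditive_below) (rule zigzag_step[OF W])
      moreover have "0 \<le> (\<Sum>z\<in>generation N t. \<Phi> z)" by (rule sum_nonneg) (rule bottom)
      ultimately show ?thesis by linarith
    qed
    finally show ?thesis by simp
  qed
  have small_\<Phi>: "\<Phi> t \<le> c * (2 * s) powr q * tau t powr (1 - q)"
    if t: "A \<subseteq> T t" and big: "2 * s / e \<le> tau t" for t
  proof -
    have "\<bar>finite_proj t\<bar> \<le> s / tau t" "\<bar>average t\<bar> \<le> s / tau t"
      using top_bounds[OF t] unfolding s_def by simp_all
    then have "\<bar>finite_proj t\<bar> \<le> 2 * s / tau t" "\<bar>average t - finite_proj t\<bar> \<le> 2 * s / tau t" by linarith+
    moreover have "2 * s / tau t \<le> e" using big e tau_pos[of t] by (simp add: field_simps)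
    ultimately have "\<Phi> t \<le> tau t * (c * (2 * s / tau t) powr q)"
      unfolding \<Phi>_def using tau_pos[of t] by (intro mult_left_mono small) auto
    also have "\<dots> = c * (2 * s) powr q * tau t powr (1 - q)"
      using tau_pos[of t] s by (simp add: powr_divide powr_diff)
    finally show ?thesis .
  qed
  have "\<forall>\<^sub>F n in sequentially. (\<Sum>x\<in>F. mu x * H (finite_proj x)) - (\<Sum>x\<in>A. mu x * G (f x))
      \<le> c * (2 * s) powr q * tau (anc n r) powr (1 - q)"
  proof -
    have "\<forall>\<^sub>F n in sequentially. 2 * s / e \<le> tau (anc n r)"
      using tau_anc_at_top[of r] by (auto simp: filterlim_at_top)
    moreover have "\<forall>\<^sub>F n in sequentially. F \<union> A \<subseteq> T (anc n r)"
      using F finA by (intro common_ancestor) simp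
    ultimately show ?thesis
    proof eventually_elim
      case (elim n)
      with le_\<Phi>[of "anc n r"] small_\<Phi>[of "anc n r"] show ?case by simp
    qed
  qed
  moreover have "(\<lambda>n. c * (2 * s) powr q * tau (anc n r) powr (1 - q)) \<longlonglongrightarrow> 0"
    using q by (intro tendsto_mult_right_zero tendsto_neg_powr tau_anc_at_top) simp
  ultimately have "(\<Sum>x\<in>F. mu x * H (finite_proj x)) - (\<Sum>x\<in>A. mu x * G (f x)) \<le> 0"
    by (intro tendsto_lowerbound[OF _ _ sequentially_bot])
  then show ?thesis by simp
qed

end

lemma strong_type_finite:
  assumes "p > 1"
  shows "\<exists>C\<ge>0. \<forall>A f F. finite A \<longrightarrow> finite F \<longrightarrow>
    (\<Sum>x\<in>F. mu x * \<bar>finite_proj A f x\<bar> powr p) \<le> C * (\<Sum>x\<in>A. mu x * \<bar>f x\<bar> powr p)"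
proof -
  define k where "k = p - \<bar>p - 2\<bar>"
  define b where "b = p * (2 * p / k) powr (p - 1)"
  have k: "k > 0" using assms by (auto simp: k_def)
  have b: "b \<ge> 0" using assms by (simp add: b_def)
  have "(\<Sum>x\<in>F. mu x * \<bar>finite_proj A f x\<bar> powr p) \<le> (2 * b / k) * (\<Sum>x\<in>A. mu x * \<bar>f x\<bar> powr p)"
    if fin: "finite A" "finite F" for A F f
  proof -
    have "(\<Sum>x\<in>F. mu x * (k / 2 * \<bar>finite_proj A f x\<bar> powr p)) \<le> (\<Sum>x\<in>A. mu x * (b * \<bar>f x\<bar> powr p))"
    proof (rule burkholder_bound[OF fin(1), where e = 1, OF strong_type_function_concave[OF assms]])
      show "k / 2 * \<bar>u\<bar> powr p \<le> strong_type_function p u v + b * \<bar>u + v\<bar> powr p" for u v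
        unfolding k_def b_def by (rule strong_type_function_majorizes[OF assms])
      show "strong_type_function p u v \<le> p * M powr p" if "\<bar>u\<bar> \<le> M" "\<bar>v\<bar> \<le> M" for u v M
        by (rule strong_type_function_small[OF assms that])
    qed (use k assms fin in auto)
    then have "k / 2 * (\<Sum>x\<in>F. mu x * \<bar>finite_proj A f x\<bar> powr p) \<le> b * (\<Sum>x\<in>A. mu x * \<bar>f x\<bar> powr p)"
      by (simp add: sum_distrib_left mult_ac)
    then show ?thesis using k by (simp add: field_simps)
  qed
  moreover have "2 * b / k \<ge> 0" using b k by simp
  ultimately show ?thesis by blast
qed

text \<open>
The threshold of the special function is \<open>1/2\<close>, which is why \<open>f\<close> is rescaled by \<open>2 t\<close>.
\<close>

lemma weak_type_finite:
  assumes fin: "finite A" "finite F" and t: "t > 0" and F: "\<And>x. x \<in> F \<Longrightarrow> \<bar>finite_proj A f x\<bar> \<ge> t"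
  shows "(\<Sum>x\<in>F. mu x) \<le> (\<Sum>x\<in>A. mu x * \<bar>f x\<bar>) / t"
proof -
  let ?f = "\<lambda>x. f x / (2 * t)"
  have finite_proj: "finite_proj A ?f x = finite_proj A f x / (2 * t)" for x
    by (simp add: finite_proj_def[OF fin(1)] sum_divide_distrib)
  have "(\<Sum>x\<in>F. mu x * (if \<bar>finite_proj A ?f x\<bar> \<ge> 1/2 then 1 else 0)) \<le> (\<Sum>x\<in>A. mu x * (2 * \<bar>?f x\<bar>))"
  proof (rule burkholder_bound[OF fin(1), where e = "1/2" and q = 2 and c = 4,
        OF weak_type_function_concave])
    show "(if \<bar>u\<bar> \<ge> 1/2 then 1 else 0) \<le> weak_type_function u v + 2 * \<bar>u + v\<bar>" for u v
      by (rule weak_type_function_majorizes)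
  qed (use fin weak_type_function_small in auto)
  also have "(\<Sum>x\<in>F. mu x * (if \<bar>finite_proj A ?f x\<bar> \<ge> 1/2 then 1 else 0)) = (\<Sum>x\<in>F. mu x)"
  proof (rule sum.cong[OF refl])
    fix x assume "x \<in> F"
    then have "\<bar>finite_proj A ?f x\<bar> \<ge> 1/2" unfolding finite_proj using F[of x] t by (simp add: field_simps)
    then show "mu x * (if \<bar>finite_proj A ?f x\<bar> \<ge> 1/2 then 1 else 0) = mu x" by (simp only: if_True mult_1_right)
  qed
  also have "(\<Sum>x\<in>A. mu x * (2 * \<bar>?f x\<bar>)) = (\<Sum>x\<in>A. mu x * \<bar>f x\<bar>) / t"
    using t by (simp add: sum_divide_distrib abs_mult)
  finally show ?thesis .
qed

text \<open>
By symmetry, the kernel at \<open>x\<close> is the projection of a multiple of the point mass at \<open>x\<close>, so the finite bound for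
\<open>p = 2\<close> controls all finite partial sums.
\<close>

lemma K_square_summable: "(\<lambda>y. mu y * (K x y)\<^sup>2) summable_on UNIV"
proof -
  obtain C where C: "\<And>A f F. finite A \<Longrightarrow> finite F \<Longrightarrow>
    (\<Sum>x\<in>F. mu x * \<bar>finite_proj A f x\<bar> powr 2) \<le> C * (\<Sum>x\<in>A. mu x * \<bar>f x\<bar> powr 2)"
    using strong_type_finite[of 2] by auto
  have "(\<lambda>y. mu y * (K x y * mu x)\<^sup>2) summable_on UNIV"
  proof (rule nonneg_bdd_above_summable_on)
    show "0 \<le> mu y * (K x y * mu x)\<^sup>2" for y using mu_pos[of y] by simp
    show "bdd_above (sum (\<lambda>y. mu y * (K x y * mu x)\<^sup>2) ` {F. F \<subseteq> UNIV \<and> finite F})"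
    proof (rule bdd_aboveI2)
      fix F :: "'a set" assume "F \<in> {F. F \<subseteq> UNIV \<and> finite F}"
      then have "(\<Sum>y\<in>F. mu y * \<bar>finite_proj {x} (\<lambda>_. 1) y\<bar> powr 2) \<le> C * (\<Sum>x\<in>{x}. mu x * \<bar>1\<bar> powr 2)"
        by (intro C) auto
      then show "(\<Sum>y\<in>F. mu y * (K x y * mu x)\<^sup>2) \<le> C * mu x"
        by (simp add: finite_proj_def K_sym[of x])
    qed
  qed
  from summable_on_cmult_left[OF this, of "1 / (mu x)\<^sup>2"]
  show ?thesis using mu_pos[of x] by (simp add: power_mult_distrib)
qed

section \<open>Passage to the limit\<close>

definition proj :: "('a \<Rightarrow> complex) \<Rightarrow> 'a \<Rightarrow> complex" where
  "proj f x = (\<Sum>\<^sub>\<infinity>y\<in>UNIV. complex_of_real (K x y) * f y * complex_of_real (mu y))"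

definition truncated_proj :: "'a set \<Rightarrow> ('a \<Rightarrow> complex) \<Rightarrow> 'a \<Rightarrow> complex" where
  "truncated_proj A f x = (\<Sum>y\<in>A. complex_of_real (K x y) * f y * complex_of_real (mu y))"

text \<open>
Absolute convergence comes from \<open>\<bar>K f\<bar> \<le> K\<^sup>2 + \<bar>f\<bar>\<^sup>2\<close>.
\<close>

lemma truncated_proj_tendsto_proj:
  assumes L2: "(\<lambda>y. mu y * (norm (f y))\<^sup>2) summable_on UNIV"
  shows "((\<lambda>A. truncated_proj A f x) \<longlongrightarrow> proj f x) (finite_subsets_at_top UNIV)"
proof -
  let ?h = "\<lambda>y. complex_of_real (K x y) * f y * complex_of_real (mu y)"
  have "(\<lambda>y. mu y * (K x y)\<^sup>2 + mu y * (norm (f y))\<^sup>2) summable_on UNIV"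
    by (intro summable_on_add K_square_summable L2)
  then have "(\<lambda>y. norm (?h y)) summable_on UNIV"
  proof (rule summable_on_comparison_test)
    fix y
    have "2 * (\<bar>K x y\<bar> * norm (f y)) \<le> (K x y)\<^sup>2 + (norm (f y))\<^sup>2"
      using sum_squares_bound[of "\<bar>K x y\<bar>" "norm (f y)"] by (simp add: mult.assoc)
    moreover have "0 \<le> \<bar>K x y\<bar> * norm (f y)" by simp
    ultimately have "\<bar>K x y\<bar> * norm (f y) \<le> (K x y)\<^sup>2 + (norm (f y))\<^sup>2" by linarith
    then have "mu y * (\<bar>K x y\<bar> * norm (f y)) \<le> mu y * ((K x y)\<^sup>2 + (norm (f y))\<^sup>2)"
      using mu_pos[of y] by (intro mult_left_mono) auto
    then show "norm (?h y) \<le> mu y * (K x y)\<^sup>2 + mu y * (norm (f y))\<^sup>2"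
      using mu_pos[of y] by (simp add: norm_mult algebra_simps)
  qed auto
  then have "?h summable_on UNIV" by (rule abs_summable_summable)
  then show ?thesis unfolding truncated_proj_def proj_def by (rule infsum_tendsto)
qed

lemma truncated_proj_Re_Im:
  assumes "finite A"
  shows "Re (truncated_proj A f x) = finite_proj A (\<lambda>y. Re (f y)) x" "Im (truncated_proj A f x) = finite_proj A (\<lambda>y. Im (f y)) x"
  by (simp_all add: truncated_proj_def finite_proj_def[OF assms])

lemma sum_le_infsum_mu:
  assumes "(\<lambda>y. mu y * h y) summable_on UNIV" "finite A" "\<And>y. 0 \<le> h y" "\<And>y. h' y \<le> h y"
  shows "(\<Sum>y\<in>A. mu y * h' y) \<le> (\<Sum>\<^sub>\<infinity>y\<in>UNIV. mu y * h y)"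
proof -
  have "(\<Sum>y\<in>A. mu y * h' y) \<le> (\<Sum>y\<in>A. mu y * h y)"
    using assms mu_pos by (intro sum_mono mult_left_mono) (auto intro: less_imp_le)
  also have "\<dots> \<le> (\<Sum>\<^sub>\<infinity>y\<in>UNIV. mu y * h y)"
    using assms by (intro finite_sum_le_infsum mult_nonneg_nonneg less_imp_le[OF mu_pos]) auto
  finally show ?thesis .
qed

text \<open>
A finite set of vertices sees only finitely many pointwise limits, so the bounds for the truncated
projections carry over to the limit. The kernel is real, so the real and the imaginary part are treated separately.
\<close>

lemma proj_strong_type:
  assumes p: "p > 1"
  shows "\<exists>C\<ge>0. \<forall>f F. (\<lambda>y. mu y * (norm (f y))\<^sup>2) summable_on UNIV \<longrightarrow>
    (\<lambda>y. mu y * norm (f y) powr p) summable_on UNIV \<longrightarrow> finite F \<longrightarrow>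
    (\<Sum>x\<in>F. mu x * norm (proj f x) powr p) \<le> C * (\<Sum>\<^sub>\<infinity>y\<in>UNIV. mu y * norm (f y) powr p)"
proof -
  obtain C where C0: "C \<ge> 0" and C: "\<And>A f F. finite A \<Longrightarrow> finite F \<Longrightarrow>
    (\<Sum>x\<in>F. mu x * \<bar>finite_proj A f x\<bar> powr p) \<le> C * (\<Sum>x\<in>A. mu x * \<bar>f x\<bar> powr p)"
    using strong_type_finite[OF p] by auto
  have cplx: "norm z powr p \<le> 2 powr p * (\<bar>Re z\<bar> powr p + \<bar>Im z\<bar> powr p)" for z
  proof -
    have "norm z \<le> 2 * max \<bar>Re z\<bar> \<bar>Im z\<bar>" using cmod_le[of z] by simp
    then have "norm z powr p \<le> (2 * max \<bar>Re z\<bar> \<bar>Im z\<bar>) powr p"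
      using p by (intro powr_mono2) auto
    also have "\<dots> = 2 powr p * max \<bar>Re z\<bar> \<bar>Im z\<bar> powr p" by (rule powr_mult)
    also have "\<dots> \<le> 2 powr p * (\<bar>Re z\<bar> powr p + \<bar>Im z\<bar> powr p)"
      by (intro mult_left_mono) (auto simp: max_def)
    finally show ?thesis .
  qed
  have "(\<Sum>x\<in>F. mu x * norm (proj f x) powr p)
      \<le> 2 powr p * (C + C) * (\<Sum>\<^sub>\<infinity>y\<in>UNIV. mu y * norm (f y) powr p)" (is "_ \<le> ?R")
    if L2: "(\<lambda>y. mu y * (norm (f y))\<^sup>2) summable_on UNIV"
      and Lp: "(\<lambda>y. mu y * norm (f y) powr p) summable_on UNIV" and F: "finite F" for f F
  proof (rule tendsto_upperbound)
    show "((\<lambda>A. \<Sum>x\<in>F. mu x * norm (truncated_proj A f x) powr p) \<longlongrightarrow>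
        (\<Sum>x\<in>F. mu x * norm (proj f x) powr p)) (finite_subsets_at_top UNIV)"
      using p by (intro tendsto_intros truncated_proj_tendsto_proj L2 tendsto_powr') auto
    have "(\<Sum>x\<in>F. mu x * norm (truncated_proj A f x) powr p) \<le> ?R" if A: "finite A" for A
    proof -
      let ?I = "\<Sum>\<^sub>\<infinity>y\<in>UNIV. mu y * norm (f y) powr p"
      have "(\<Sum>x\<in>F. mu x * norm (truncated_proj A f x) powr p) \<le>
        (\<Sum>x\<in>F. mu x * (2 powr p * (\<bar>Re (truncated_proj A f x)\<bar> powr p + \<bar>Im (truncated_proj A f x)\<bar> powr p)))"
        by (intro sum_mono mult_left_mono cplx less_imp_le[OF mu_pos])
      also have "\<dots> = 2 powr p * ((\<Sum>x\<in>F. mu x * \<bar>finite_proj A (\<lambda>y. Re (f y)) x\<bar> powr p)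
          + (\<Sum>x\<in>F. mu x * \<bar>finite_proj A (\<lambda>y. Im (f y)) x\<bar> powr p))"
        by (simp add: truncated_proj_Re_Im[OF A] sum_distrib_left sum.distrib algebra_simps)
      also have "\<dots> \<le> 2 powr p * (C * (\<Sum>x\<in>A. mu x * \<bar>Re (f x)\<bar> powr p)
          + C * (\<Sum>x\<in>A. mu x * \<bar>Im (f x)\<bar> powr p))"
        by (intro mult_left_mono add_mono C A F) simp
      also have "\<dots> \<le> 2 powr p * (C * ?I + C * ?I)"
        using p by (intro mult_left_mono add_mono sum_le_infsum_mu A Lp C0 powr_mono2
            abs_Re_le_cmod abs_Im_le_cmod) auto
      finally show ?thesis by (simp add: algebra_simps)
    qed
    then show "\<forall>\<^sub>F A in finite_subsets_at_top UNIV.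
        (\<Sum>x\<in>F. mu x * norm (truncated_proj A f x) powr p) \<le> ?R"
      by (intro eventually_finite_subsets_at_top_weakI)
  qed simp
  moreover have "2 powr p * (C + C) \<ge> 0" using C0 by simp
  ultimately show ?thesis by blast
qed

text \<open>
The inequality \<open>\<bar>\<P> f\<bar> > t\<close> is strict, so it holds on the finite set \<open>F\<close> already for a truncated projection.
There, the real or the imaginary part is at least \<open>t / 2\<close>.
\<close>

lemma proj_weak_type:
  assumes L2: "(\<lambda>y. mu y * (norm (f y))\<^sup>2) summable_on UNIV"
    and L1: "(\<lambda>y. mu y * norm (f y)) summable_on UNIV"
    and F: "finite F" and t: "t > 0" and big: "\<And>x. x \<in> F \<Longrightarrow> norm (proj f x) > t"
  shows "(\<Sum>x\<in>F. mu x) \<le> 4 * (\<Sum>\<^sub>\<infinity>y\<in>UNIV. mu y * norm (f y)) / t"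
proof -
  let ?I = "\<Sum>\<^sub>\<infinity>y\<in>UNIV. mu y * norm (f y)"
  have "\<forall>x\<in>F. \<forall>\<^sub>F A in finite_subsets_at_top UNIV. norm (truncated_proj A f x) > t"
    using big order_tendstoD(1)[OF tendsto_norm[OF truncated_proj_tendsto_proj[OF L2]]] by blast
  then have "\<forall>\<^sub>F A in finite_subsets_at_top UNIV. \<forall>x\<in>F. norm (truncated_proj A f x) > t"
    by (rule eventually_ball_finite[OF F])
  then obtain A where A': "finite A"
    "\<forall>Y. finite Y \<and> A \<subseteq> Y \<and> Y \<subseteq> UNIV \<longrightarrow> (\<forall>x\<in>F. norm (truncated_proj Y f x) > t)"
    unfolding eventually_finite_subsets_at_top by (elim exE conjE)
  with spec[OF A'(2), of A] have A: "finite A" "\<And>x. x \<in> F \<Longrightarrow> norm (truncated_proj A f x) > t"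
    by simp_all
  let ?F1 = "{x\<in>F. \<bar>finite_proj A (\<lambda>y. Re (f y)) x\<bar> \<ge> t / 2}" and ?F2 = "{x\<in>F. \<bar>finite_proj A (\<lambda>y. Im (f y)) x\<bar> \<ge> t / 2}"
  have "x \<in> ?F1 \<union> ?F2" if "x \<in> F" for x
  proof -
    have "t < \<bar>Re (truncated_proj A f x)\<bar> + \<bar>Im (truncated_proj A f x)\<bar>"
      using A(2)[OF that] cmod_le[of "truncated_proj A f x"] by linarith
    then show ?thesis using that by (auto simp: truncated_proj_Re_Im[OF A(1)])
  qed
  then have "(\<Sum>x\<in>F. mu x) \<le> (\<Sum>x\<in>?F1 \<union> ?F2. mu x)"
    using F by (intro sum_mono2) (auto intro: less_imp_le[OF mu_pos])
  also have "\<dots> \<le> (\<Sum>x\<in>?F1. mu x) + (\<Sum>x\<in>?F2. mu x)"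
    using F sum_nonneg[of "?F1 \<inter> ?F2" mu] by (subst sum_Un) (auto intro: less_imp_le[OF mu_pos])
  also have "\<dots> \<le> (\<Sum>x\<in>A. mu x * \<bar>Re (f x)\<bar>) / (t / 2) + (\<Sum>x\<in>A. mu x * \<bar>Im (f x)\<bar>) / (t / 2)"
    using F A(1) t by (intro add_mono weak_type_finite) auto
  also have "\<dots> \<le> ?I / (t / 2) + ?I / (t / 2)"
    using t by (intro add_mono divide_right_mono sum_le_infsum_mu A L1 abs_Re_le_cmod abs_Im_le_cmod) auto
  finally show ?thesis by simp
qed

end

section \<open>Lebesgue spaces over a weighted discrete set\<close>

lemma Lp_point_measure:
  fixes w :: "'a \<Rightarrow> real" and f :: "'a \<Rightarrow> complex"
  assumes w: "\<And>x. w x \<ge> 0"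
  defines "M \<equiv> point_measure UNIV (\<lambda>x. ennreal (w x))"
  shows "f \<in> Lp_space M p \<longleftrightarrow> (\<lambda>x. w x * norm (f x) powr p) summable_on UNIV"
    and "f \<in> Lp_space M p \<Longrightarrow>
      Lp_norm M p f = (\<Sum>\<^sub>\<infinity>x\<in>UNIV. w x * norm (f x) powr p) powr (1 / p)"
proof -
  let ?h = "\<lambda>x. norm (f x) powr p"
  have M: "M = density (count_space UNIV) (\<lambda>x. ennreal (w x))"
    by (simp add: M_def point_measure_def)
  have abs: "(\<lambda>x. norm (w x * ?h x)) = (\<lambda>x. w x * ?h x)" using w by (auto simp: abs_mult)
  have "integrable M ?h \<longleftrightarrow> integrable (count_space UNIV) (\<lambda>x. w x *\<^sub>R ?h x)"
    unfolding M by (rule integrable_density) (use w in auto)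
  also have "\<dots> \<longleftrightarrow> (\<lambda>x. w x * ?h x) summable_on UNIV"
    using abs_summable_equivalent[of "\<lambda>x. w x * ?h x" UNIV]
    unfolding abs by (simp add: abs_summable_on_def)
  finally show iff: "f \<in> Lp_space M p \<longleftrightarrow> (\<lambda>x. w x * ?h x) summable_on UNIV"
    by (simp add: Lp_space_def M_def)
  assume "f \<in> Lp_space M p"
  then have "Infinite_Set_Sum.abs_summable_on (\<lambda>x. w x * ?h x) UNIV"
    unfolding iff abs_summable_equivalent[symmetric] abs .
  then have "(\<integral>x. w x * ?h x \<partial>count_space UNIV) = (\<Sum>\<^sub>\<infinity>x\<in>UNIV. w x * ?h x)"
    by (simp flip: infsetsum_infsum add: infsetsum_def)
  moreover have "integral\<^sup>L M ?h = (\<integral>x. w x *\<^sub>R ?h x \<partial>count_space UNIV)"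
    unfolding M by (rule integral_density) (use w in auto)
  ultimately show "Lp_norm M p f = (\<Sum>\<^sub>\<infinity>x\<in>UNIV. w x * ?h x) powr (1 / p)"
    by (simp add: Lp_norm_def)
qed

lemma emeasure_point_measure_le:
  assumes w: "\<And>x. w x \<ge> (0::real)" and bound: "\<And>F. finite F \<Longrightarrow> F \<subseteq> X \<Longrightarrow> (\<Sum>x\<in>F. w x) \<le> c"
  shows "emeasure (point_measure UNIV (\<lambda>x. ennreal (w x))) X \<le> ennreal c"
proof -
  have sum: "w summable_on X"
    using w bound by (intro nonneg_bdd_above_summable_on bdd_aboveI2) auto
  have "(\<lambda>x. norm (w x)) = w" using w by auto
  with sum have abs: "Infinite_Set_Sum.abs_summable_on w X" by (simp flip: abs_summable_equivalent)
  have "emeasure (point_measure UNIV (\<lambda>x. ennreal (w x))) X = (\<integral>\<^sup>+x\<in>X. ennreal (w x) \<partial>count_space UNIV)"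
    by (simp add: point_measure_def emeasure_density)
  also have "\<dots> = (\<integral>\<^sup>+x. ennreal (w x) \<partial>count_space X)"
    by (cases "X = UNIV") (simp_all add: nn_integral_count_space_indicator)
  also have "\<dots> = ennreal (infsum w X)"
    using abs w by (simp add: nn_integral_conv_infsetsum infsetsum_infsum)
  also have "\<dots> \<le> ennreal c"
    by (intro ennreal_leI infsum_le_finite_sums[OF sum] bound)
  finally show ?thesis .
qed

section \<open>Boundedness of the Bergman projection\<close>

theorem theorem2p11:
  fixes E :: "'a rel" and r :: 'a and \<omega> :: "(nat \<Rightarrow> 'a) set"
    and m :: "'a \<Rightarrow> real" and \<sigma> :: "int \<Rightarrow> real"
  assumes "infinite (UNIV :: 'a set)"
    and "graph_tree E"
    and "locally_finite_graph E"
    and "\<omega> \<in> tree_boundary E r"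
    and "\<forall>x. successors E \<omega> x \<noteq> {}"
    and "flow_measure E \<omega> m"
    and "\<forall>n. \<sigma> n > 0"
    and "\<forall>k. \<sigma> summable_on {..k}"
    and "summable (\<lambda>n. 1 / (\<sigma> (int n) * m ((predecessor E \<omega> ^^ n) r)))"
  shows "(\<forall>p>1. bounded_on_Lp (weighted_measure E \<omega> m \<sigma>) (Bergman_projection E \<omega> m \<sigma>) p)
       \<and> weak_type_1_1 (weighted_measure E \<omega> m \<sigma>) (Bergman_projection E \<omega> m \<sigma>)"
proof -
  interpret tree_with_end E r \<omega>
    by unfold_locales (use assms in auto)
  have level_anc: "level E \<omega> ((pr ^^ n) x) = level E \<omega> x + int n" for n x
    by (induction n) (simp_all add: predecessor)
  interpret flow_tree pr "level E \<omega>" m \<sigma> r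
  proof
    show "level E \<omega> (pr x) = level E \<omega> x + 1" for x by (rule predecessor)
    show "finite {y. pr y = x}" for x by (rule finite_successors)
    show "\<exists>n k. (pr ^^ n) x = (pr ^^ k) y" for x y by (rule confluent)
    show "m x > 0" "m x = (\<Sum>y | pr y = x. m y)" for x
      using assms(6) unfolding flow_measure_def successors_eq by blast+
    show "\<sigma> n > 0" "\<sigma> summable_on {..k}" for n k using assms by blast+
    show "summable (\<lambda>n. 1 / (\<sigma> (level E \<omega> ((pr ^^ n) r)) * m ((pr ^^ n) r)))"
      using assms(9) by (simp add: level_anc level_origin)
  qed
  have sector: "sector E \<omega> x = T x" for x by (simp add: sector_eq T_def)
  have kernel: "Bergman_kernel E \<omega> m \<sigma> x y = K x y" for x y
    unfolding Bergman_kernel_def K_def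
  proof (rule suminf_cong)
    fix n
    define v z where "v = anc (n + 1) x" and "z = anc n x"
    have v: "v = pr z" "z \<in> T v - {v}"
    proof -
      show "v = pr z" by (simp add: v_def z_def)
      then have "level E \<omega> z \<noteq> level E \<omega> v" using predecessor(2)[of z] by simp
      then show "z \<in> T v - {v}" using \<open>v = pr z\<close> T_pr[OF T_refl[of z]] by auto
    qed
    \<comment> \<open>\<open>z\<close> is the only successor of \<open>v\<close> whose sector contains \<open>z\<close>, so the case distinction in
      \<open>Psi\<close> is whether \<open>y\<close> lies in the sector of \<open>z\<close>\<close>
    have child: "u = z" if "pr u = v" "z \<in> T u" for u
      using that v predecessor(2)[of u] predecessor(2)[of z] T_same_level[OF T_refl[of z], of u] by simp
    have *: "(\<exists>u\<in>successors E \<omega> v. {y, z} \<subseteq> sector E \<omega> u) \<longleftrightarrow> y \<in> T z"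
      unfolding successors_eq sector using child v T_refl by auto
    have **: "(THE u. u \<in> successors E \<omega> v \<and> y \<in> T u \<and> z \<in> T u) = z" if "y \<in> T z"
      unfolding successors_eq by (rule the_equality) (use child v T_refl that in auto)
    have "y \<in> T v - {v}" if "y \<in> T z" using that v unfolding punctured_T by blast
    then have "Psi E \<omega> m v z y = of_bool (y \<in> T z) / m z - of_bool (y \<in> T v - {v}) / m v"
      using v(2) unfolding Psi_def punctured_sector_def * by (auto simp: sector **)
    moreover have "S_sum E \<omega> \<sigma> (int n) x = S (level E \<omega> z)"
      by (simp add: S_sum_def S_def z_def level_anc)
    ultimately show "Psi E \<omega> m ((pr ^^ (n + 1)) x) ((pr ^^ n) x) y / S_sum E \<omega> \<sigma> (int n) x = kernel_term x y n"
      unfolding kernel_term_def tau_def tau'_def v_def[symmetric] z_def[symmetric]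
      by (simp add: diff_divide_distrib v(1) predecessor flip: v_def z_def)
  qed
  have proj: "Bergman_projection E \<omega> m \<sigma> = proj"
    by (intro ext) (simp add: Bergman_projection_def proj_def kernel mu_def)
  define M where "M = weighted_measure E \<omega> m \<sigma>"
  have M: "M = point_measure UNIV (\<lambda>x. ennreal (mu x))"
    by (simp add: M_def weighted_measure_def mu_def)
  have mu: "mu x \<ge> 0" for x using mu_pos[of x] by simp
  have Lp: "f \<in> Lp_space M p \<longleftrightarrow> (\<lambda>x. mu x * norm (f x) powr p) summable_on UNIV" for f p
    unfolding M by (rule Lp_point_measure(1)[OF mu])
  have norm: "Lp_norm M p f = (\<Sum>\<^sub>\<infinity>x\<in>UNIV. mu x * norm (f x) powr p) powr (1 / p)"
    if "f \<in> Lp_space M p" for f p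
    using that unfolding M by (rule Lp_point_measure(2)[OF mu])
  have L2: "(\<lambda>x. mu x * (norm (f x))\<^sup>2) summable_on UNIV" if "f \<in> Lp_space M 2" for f
    using that unfolding Lp by simp
  have strong: "bounded_on_Lp M proj p" if p: "p > 1" for p
  proof -
    obtain C where C0: "C \<ge> 0" and C: "\<And>f F. (\<lambda>y. mu y * (norm (f y))\<^sup>2) summable_on UNIV \<Longrightarrow>
      (\<lambda>y. mu y * norm (f y) powr p) summable_on UNIV \<Longrightarrow> finite F \<Longrightarrow>
      (\<Sum>x\<in>F. mu x * norm (proj f x) powr p) \<le> C * (\<Sum>\<^sub>\<infinity>y\<in>UNIV. mu y * norm (f y) powr p)"
      using proj_strong_type[OF p] by blast
    have "proj f \<in> Lp_space M p \<and> Lp_norm M p (proj f) \<le> C powr (1 / p) * Lp_norm M p f"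
      if f: "f \<in> Lp_space M 2 \<inter> Lp_space M p" for f
    proof -
      let ?I = "\<Sum>\<^sub>\<infinity>y\<in>UNIV. mu y * norm (f y) powr p"
      have fin: "(\<Sum>x\<in>F. mu x * norm (proj f x) powr p) \<le> C * ?I" if "finite F" for F
        using f L2 Lp that by (intro C) auto
      have sum: "(\<lambda>x. mu x * norm (proj f x) powr p) summable_on UNIV"
        by (rule nonneg_bdd_above_summable_on) (auto intro: bdd_aboveI2 fin mult_nonneg_nonneg mu)
      then have mem: "proj f \<in> Lp_space M p" by (simp add: Lp)
      have "(\<Sum>\<^sub>\<infinity>x\<in>UNIV. mu x * norm (proj f x) powr p) powr (1 / p) \<le> (C * ?I) powr (1 / p)"
        using p by (intro powr_mono2 infsum_le_finite_sums[OF sum] fin infsum_nonneg mult_nonneg_nonneg mu) auto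
      also have "\<dots> = C powr (1 / p) * ?I powr (1 / p)" by (rule powr_mult)
      finally show ?thesis using mem f by (simp add: norm)
    qed
    then show ?thesis unfolding bounded_on_Lp_def by blast
  qed
  have weak: "weak_type_1_1 M proj"
    unfolding weak_type_1_1_def
  proof (intro exI[of _ 4] conjI allI impI ballI)
    fix t :: real and f assume t: "t > 0" and f: "f \<in> Lp_space M 1 \<inter> Lp_space M 2"
    let ?I = "\<Sum>\<^sub>\<infinity>y\<in>UNIV. mu y * norm (f y)"
    have L1: "(\<lambda>y. mu y * norm (f y)) summable_on UNIV" using f by (simp add: Lp)
    have "0 \<le> ?I" by (intro infsum_nonneg mult_nonneg_nonneg mu) simp
    then have I: "Lp_norm M 1 f = ?I" using f by (simp add: norm)
    show "emeasure M {x \<in> space M. t < norm (proj f x)} \<le> ennreal (4 * Lp_norm M 1 f / t)"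
      unfolding I unfolding M
    proof (rule emeasure_point_measure_le[OF mu])
      fix F assume "finite F" "F \<subseteq> {x \<in> space (point_measure UNIV (\<lambda>x. ennreal (mu x))). t < norm (proj f x)}"
      then show "sum mu F \<le> 4 * ?I / t"
        using f L2 L1 t by (intro proj_weak_type) auto
    qed
  qed simp
  show ?thesis using strong weak by (simp add: proj M_def)
qed

end
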